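(* There is no transformation $T$ of a non-atomic standard Borel probability space $(X,\mathcal{F},\mu)$ with spectrum generated by one $3$-fold Lebesgue function. That is, there do not exist a transformation $T$ of $(X,\mathcal{F},\mu)$ and a $3$-fold Lebesgue function $f$ for $T$ such that $L_0^2(\mu)=C(f)$.
   Context: A transformation $T$ is an invertible measure-preserving map of a non-atomic standard Borel probability space $(X,\mathcal{F},\mu)$. $L^2(\mu)$ is the space of complex-valued square-integrable functions. The Koopman operator is the unitary operator $\widehat{T}:L^2(\mu)\to L^2(\mu)$, $\widehat{T}f(x)=f(Tx)$. $L_0^2(\mu)=\{f\in L^2(\mu):\int_X f\,d\mu=0\}$. For $f_1,f_2,\ldots\in L^2(\mu)$, $C(f_1,f_2,\ldots)$ denotes the minimal closed $\widehat{T}$-invariant subspace of $L^2(\mu)$ containing $f_1,f_2,\ldots$, where invariance is under both $\widehat{T}$ and $\widehat{T}^{-1}$; i.e. the closed linear span of $\{\widehat{T}^n f_i: n\in\mathbb{Z},\ i\ge 1\}$. A non-zero function $f\in L^2(\mu)$ is $3$-fold Lebesgue for $T$ if for any two different non-zero integers $n_1,n_2$: (i) $\widehat{T}^{n_1}f\cdot\widehat{T}^{n_2}f\in L^2(\mu)$; and (ii) $\int_X\widehat{T}^{n_1}f\cdot\widehat{T}^{n_2}f\cdot\overline{f}\,d\mu=0$. (This is the case $k=3$ of the notion of a $k$-fold Lebesgue function.) *)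

theory Defs
  imports "HOL-Probability.Probability"
begin

definition standard_Borel :: "'a measure \<Rightarrow> bool" where
  "standard_Borel M \<longleftrightarrow>
     (\<exists>X. completely_metrizable_space X \<and> second_countable X \<and> topspace X = space M \<and>
          sets M = sigma_sets (topspace X) {U. openin X U})"

definition nonatomic :: "'a measure \<Rightarrow> bool" where
  "nonatomic M \<longleftrightarrow>
     (\<forall>A \<in> sets M. 0 < emeasure M A \<longrightarrow>
        (\<exists>B \<in> sets M. B \<subseteq> A \<and> 0 < emeasure M B \<and> emeasure M B < emeasure M A))"

text \<open>Invertibility is meant pointwise on the space, with measurable inverse.\<close>

definition transformation :: "'a measure \<Rightarrow> ('a \<Rightarrow> 'a) \<Rightarrow> bool" where
  "transformation M T \<longleftrightarrow>
     bij_betw T (space M) (space M) \<and>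
     T \<in> M \<rightarrow>\<^sub>M M \<and> inv_into (space M) T \<in> M \<rightarrow>\<^sub>M M \<and>
     distr M M T = M"

text \<open>
  Elements of \<open>L\<^sup>2(\<mu>)\<close> are represented by functions, not by classes modulo null sets.
  The closed subspaces below are closed under almost everywhere equality, because the
  \<open>L\<^sup>2\<close> distance of two almost everywhere equal functions is zero; so they correspond
  exactly to the closed subspaces of the Hilbert space of classes.
\<close>

definition L2 :: "'a measure \<Rightarrow> ('a \<Rightarrow> complex) set" where
  "L2 M = {f \<in> borel_measurable M. integrable M (\<lambda>x. (cmod (f x))\<^sup>2)}"

definition L2_norm :: "'a measure \<Rightarrow> ('a \<Rightarrow> complex) \<Rightarrow> real" where
  "L2_norm M f = sqrt (\<integral>x. (cmod (f x))\<^sup>2 \<partial>M)"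

definition L2_0 :: "'a measure \<Rightarrow> ('a \<Rightarrow> complex) set" where
  "L2_0 M = {f \<in> L2 M. (\<integral>x. f x \<partial>M) = 0}"

definition koopman :: "('a \<Rightarrow> 'a) \<Rightarrow> ('a \<Rightarrow> complex) \<Rightarrow> 'a \<Rightarrow> complex" where
  "koopman T f = (\<lambda>x. f (T x))"

definition koopman_inv :: "'a measure \<Rightarrow> ('a \<Rightarrow> 'a) \<Rightarrow> ('a \<Rightarrow> complex) \<Rightarrow> 'a \<Rightarrow> complex" where
  "koopman_inv M T = koopman (inv_into (space M) T)"

definition koopman_power ::
    "'a measure \<Rightarrow> ('a \<Rightarrow> 'a) \<Rightarrow> int \<Rightarrow> ('a \<Rightarrow> complex) \<Rightarrow> 'a \<Rightarrow> complex" where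
  "koopman_power M T n =
     (if 0 \<le> n then koopman T ^^ nat n else koopman_inv M T ^^ nat (- n))"

definition closed_L2_subspace :: "'a measure \<Rightarrow> ('a \<Rightarrow> complex) set \<Rightarrow> bool" where
  "closed_L2_subspace M V \<longleftrightarrow>
     V \<subseteq> L2 M \<and> (\<lambda>x. 0) \<in> V \<and>
     (\<forall>f \<in> V. \<forall>g \<in> V. (\<lambda>x. f x + g x) \<in> V) \<and>
     (\<forall>c. \<forall>f \<in> V. (\<lambda>x. c * f x) \<in> V) \<and>
     (\<forall>f \<in> L2 M. (\<forall>\<epsilon>>0. \<exists>g \<in> V. L2_norm M (\<lambda>x. f x - g x) < \<epsilon>) \<longrightarrow> f \<in> V)"

definition koopman_invariant :: "'a measure \<Rightarrow> ('a \<Rightarrow> 'a) \<Rightarrow> ('a \<Rightarrow> complex) set \<Rightarrow> bool" where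
  "koopman_invariant M T V \<longleftrightarrow> (\<forall>f \<in> V. koopman T f \<in> V \<and> koopman_inv M T f \<in> V)"

definition cyclic_space :: "'a measure \<Rightarrow> ('a \<Rightarrow> 'a) \<Rightarrow> ('a \<Rightarrow> complex) set \<Rightarrow> ('a \<Rightarrow> complex) set" where
  "cyclic_space M T F = \<Inter> {V. closed_L2_subspace M V \<and> koopman_invariant M T V \<and> F \<subseteq> V}"

text \<open>A non-zero element of \<open>L\<^sup>2(\<mu>)\<close> is a function that is not almost everywhere zero.\<close>

definition threefold_Lebesgue :: "'a measure \<Rightarrow> ('a \<Rightarrow> 'a) \<Rightarrow> ('a \<Rightarrow> complex) \<Rightarrow> bool" where
  "threefold_Lebesgue M T f \<longleftrightarrow>
     f \<in> L2 M \<and> \<not> (AE x in M. f x = 0) \<and>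
     (\<forall>n1 n2 :: int. n1 \<noteq> 0 \<longrightarrow> n2 \<noteq> 0 \<longrightarrow> n1 \<noteq> n2 \<longrightarrow>
        (\<lambda>x. koopman_power M T n1 f x * koopman_power M T n2 f x) \<in> L2 M \<and>
        (\<integral>x. koopman_power M T n1 f x * koopman_power M T n2 f x * cnj (f x) \<partial>M) = 0)"

end

theory Submission
  imports Defs "HOL-Library.Diagonal_Subsequence"
begin

text \<open>
  Let \<open>f\<close> be a 3-fold Lebesgue function with \<open>C(f) = L\<^sup>2\<^sub>0\<close>, and write \<open>f\<^sub>n\<close> for its image
  under the \<open>n\<close>-th power of the Koopman operator. Shifting the defining condition shows that,
  for \<open>m \<noteq> n\<close>, the product \<open>f\<^sub>m f\<^sub>n\<close> lies in \<open>L\<^sup>2\<close> and is orthogonal to every \<open>f\<^sub>j\<close> with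
  \<open>j \<noteq> m, n\<close>. Cyclicity gives two facts: \<open>f\<close> has mean zero, and the orbit is total, that is,
  an element of \<open>L\<^sup>2\<^sub>0\<close> orthogonal to all \<open>f\<^sub>j\<close> vanishes. The proof shows that the orbit must return close to
  itself along a sequence of times, and that this forces it to span a space of dimension one.

  \<^bold>\<open>A finite-dimensional space.\<close> Fix \<open>m \<noteq> l\<close>. For each other \<open>n\<close>, one linear condition on
  \<open>(p, q)\<close> makes \<open>f\<^sub>n (p f\<^sub>m - q f\<^sub>l)\<close> orthogonal also to \<open>f\<^sub>n\<close>, and it can be met by a unit vector.
  The product is then orthogonal to all \<open>f\<^sub>j\<close> with \<open>j \<noteq> m, l\<close>. By totality the functions with
  this property form a space of dimension at most 3, which does not depend on \<open>n\<close>. The products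
  are bounded in \<open>L\<^sup>1\<close>, so a subsequence converges in \<open>L\<^sup>1\<close> (\<open>finite_dim_L1_compactness\<close>),
  and one may let \<open>(p, q)\<close> converge as well (\<open>pair_subsequence\<close>). A diagonal argument serves all
  pairs \<open>(m, l)\<close> at once (\<open>common_subsequence\<close>).

  \<^bold>\<open>The orbit is rigid.\<close> Along this subsequence \<open>f\<^sub>n\<close> is therefore Cauchy in measure wherever some
  weight \<open>p f\<^sub>m - q f\<^sub>l\<close> with its limiting coefficients is non-zero. Where all the weights vanish,
  all \<open>f\<^sub>m\<close> are multiples of one function; since the measure has no atoms, a set of positive
  measure with that property would carry a non-zero mean-zero function orthogonal to the whole orbit
  (\<open>not_proportional_on_set\<close>). So that set is null, and because all \<open>f\<^sub>n\<close> have the same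
  distribution, \<open>f\<^sub>n\<close> is Cauchy in \<open>L\<^sup>2\<close> along the subsequence (\<open>Cauchy_subsequence\<close>). By stationarity
  there are arbitrarily large \<open>k\<close> for which \<open>f\<^bsub>a+k\<^esub>\<close> is close to \<open>f\<^sub>a\<close>, uniformly in \<open>a\<close>
  (\<open>orbit_rigid\<close>).

  \<^bold>\<open>Conclusion.\<close> The function \<open>f\<^sub>m f\<^sub>n\<close> minus its mean is orthogonal to \<open>f\<^sub>j\<close> for all large
  \<open>j\<close>, hence by rigidity for all \<open>j\<close>, so \<open>f\<^sub>m f\<^sub>n\<close> is constant for \<open>m \<noteq> n\<close>. By rigidity again
  \<open>f\<^sub>0\<^sup>2\<close> is a limit of such constants, hence a constant, and a non-zero one. Then every \<open>f\<^sub>n\<close> is a multiple of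
  \<open>f\<^sub>0\<close> on the whole space, which was just excluded.
\<close>

section \<open>Square-integrable functions\<close>

lemma L2_measurable: "u \<in> L2 M \<Longrightarrow> u \<in> borel_measurable M"
  by (simp add: L2_def)

lemma L2_square_integrable: "u \<in> L2 M \<Longrightarrow> integrable M (\<lambda>x. (cmod (u x))\<^sup>2)"
  by (simp add: L2_def)

lemma L2_mult_integrable:
  assumes "u \<in> L2 M" "v \<in> L2 M"
  shows "integrable M (\<lambda>x. u x * v x)"
proof (rule Bochner_Integration.integrable_bound)
  show "integrable M (\<lambda>x. (cmod (u x))\<^sup>2 + (cmod (v x))\<^sup>2)"
    using assms by (intro Bochner_Integration.integrable_add L2_square_integrable)
  show "(\<lambda>x. u x * v x) \<in> borel_measurable M"
    using assms[THEN L2_measurable] by measurable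
  show "AE x in M. norm (u x * v x) \<le> norm ((cmod (u x))\<^sup>2 + (cmod (v x))\<^sup>2)"
  proof (rule AE_I2)
    fix x
    have "0 \<le> (cmod (u x) - cmod (v x))\<^sup>2" "0 \<le> (cmod (u x))\<^sup>2" "0 \<le> (cmod (v x))\<^sup>2"
      by simp_all
    then show "norm (u x * v x) \<le> norm ((cmod (u x))\<^sup>2 + (cmod (v x))\<^sup>2)"
      unfolding norm_mult real_norm_def power2_diff by linarith
  qed
qed

lemma borel_measurable_cnj [measurable]:
  "u \<in> borel_measurable M \<Longrightarrow> (\<lambda>x. cnj (u x)) \<in> borel_measurable M"
  by (rule borel_measurable_continuous_on[of cnj]) (intro continuous_intros)

lemma L2_cnj: "u \<in> L2 M \<Longrightarrow> (\<lambda>x. cnj (u x)) \<in> L2 M"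
  by (auto simp: L2_def intro: borel_measurable_cnj)

lemma L2_mult_cnj_integrable:
  "u \<in> L2 M \<Longrightarrow> v \<in> L2 M \<Longrightarrow> integrable M (\<lambda>x. u x * cnj (v x))"
  by (rule L2_mult_integrable[OF _ L2_cnj])

lemma L2_norm_mult_integrable:
  "u \<in> L2 M \<Longrightarrow> v \<in> L2 M \<Longrightarrow> integrable M (\<lambda>x. cmod (u x) * cmod (v x))"
  using Bochner_Integration.integrable_norm[OF L2_mult_integrable] by (simp add: norm_mult)

lemma L2_scale: "u \<in> L2 M \<Longrightarrow> (\<lambda>x. c * u x) \<in> L2 M"
  by (auto simp: L2_def norm_mult power_mult_distrib)

lemma L2_add:
  assumes "u \<in> L2 M" "v \<in> L2 M"
  shows "(\<lambda>x. u x + v x) \<in> L2 M"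
proof -
  have "integrable M (\<lambda>x. (cmod (u x + v x))\<^sup>2)"
  proof (rule Bochner_Integration.integrable_bound)
    show "integrable M (\<lambda>x. 2 * (cmod (u x))\<^sup>2 + 2 * (cmod (v x))\<^sup>2)"
      using assms by (intro Bochner_Integration.integrable_add integrable_mult_right L2_square_integrable)
    show "(\<lambda>x. (cmod (u x + v x))\<^sup>2) \<in> borel_measurable M"
      using assms[THEN L2_measurable] by measurable
    show "AE x in M. norm ((cmod (u x + v x))\<^sup>2) \<le> norm (2 * (cmod (u x))\<^sup>2 + 2 * (cmod (v x))\<^sup>2)"
    proof (rule AE_I2)
      fix x
      have "(cmod (u x + v x))\<^sup>2 \<le> (cmod (u x) + cmod (v x))\<^sup>2"
        by (intro power_mono norm_triangle_ineq) simp
      moreover have "0 \<le> (cmod (u x) - cmod (v x))\<^sup>2" by simp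
      ultimately show "norm ((cmod (u x + v x))\<^sup>2) \<le> norm (2 * (cmod (u x))\<^sup>2 + 2 * (cmod (v x))\<^sup>2)"
        by (simp add: power2_diff power2_sum)
    qed
  qed
  then show ?thesis using assms by (auto simp: L2_def)
qed

lemma L2_diff: "u \<in> L2 M \<Longrightarrow> v \<in> L2 M \<Longrightarrow> (\<lambda>x. u x - v x) \<in> L2 M"
  using L2_add[of u M "\<lambda>x. (-1) * v x"] L2_scale[of v M "-1"] by simp

lemma L2_zero: "(\<lambda>x. 0) \<in> L2 M"
  by (simp add: L2_def)

lemma (in prob_space) L2_const: "(\<lambda>x. c) \<in> L2 M"
  by (simp add: L2_def)

lemma (in prob_space) L2_integrable: "u \<in> L2 M \<Longrightarrow> integrable M u"
  using L2_mult_integrable[OF _ L2_const[of 1]] by simp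

lemma L2_cong_AE:
  assumes "u \<in> L2 M" "v \<in> borel_measurable M" "AE x in M. u x = v x"
  shows "v \<in> L2 M"
proof -
  have "integrable M (\<lambda>x. (cmod (v x))\<^sup>2) \<longleftrightarrow> integrable M (\<lambda>x. (cmod (u x))\<^sup>2)"
    by (rule integrable_cong_AE) (use assms L2_measurable[of u M] in auto)
  then show ?thesis using assms by (simp add: L2_def)
qed

lemma L2_eq_0_AE:
  assumes "u \<in> L2 M" "(\<integral>x. u x * cnj (u x) \<partial>M) = 0"
  shows "AE x in M. u x = 0"
proof -
  have "(\<integral>x. u x * cnj (u x) \<partial>M) = complex_of_real (\<integral>x. (cmod (u x))\<^sup>2 \<partial>M)"
    by (simp add: complex_norm_square[symmetric] del: of_real_power)
  with assms(2) have "(\<integral>x. (cmod (u x))\<^sup>2 \<partial>M) = 0"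
    by simp
  then show ?thesis
    using integral_nonneg_eq_0_iff_AE[OF L2_square_integrable[OF assms(1)]] by simp
qed

text \<open>
  The discriminant of the quadratic \<open>t \<mapsto> \<integral>(\<bar>u\<bar> - t \<bar>v\<bar>)\<^sup>2\<close>, which is non-negative for all \<open>t\<close>,
  cannot be positive.
\<close>

lemma L2_Cauchy_Schwarz:
  assumes "u \<in> L2 M" "v \<in> L2 M"
  shows "(\<integral>x. cmod (u x) * cmod (v x) \<partial>M)\<^sup>2
    \<le> (\<integral>x. (cmod (u x))\<^sup>2 \<partial>M) * (\<integral>x. (cmod (v x))\<^sup>2 \<partial>M)"
    (is "?B\<^sup>2 \<le> ?A * ?C")
proof -
  have q: "0 \<le> ?A - 2 * t * ?B + t\<^sup>2 * ?C" for t
  proof -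
    have "0 \<le> (\<integral>x. (cmod (u x) - t * cmod (v x))\<^sup>2 \<partial>M)" by simp
    also have "\<dots> = (\<integral>x. (cmod (u x))\<^sup>2 - 2 * t * (cmod (u x) * cmod (v x)) + t\<^sup>2 * (cmod (v x))\<^sup>2 \<partial>M)"
      by (simp add: power2_diff power_mult_distrib algebra_simps)
    also have "\<dots> = ?A - 2 * t * ?B + t\<^sup>2 * ?C"
      using L2_square_integrable[OF assms(1)] L2_square_integrable[OF assms(2)]
        L2_norm_mult_integrable[OF assms] by simp
    finally show ?thesis .
  qed
  have C: "0 \<le> ?C" by (rule Bochner_Integration.integral_nonneg) simp
  show ?thesis
  proof (cases "?C = 0")
    case True
    then have "?B = 0"
      using q[of "(?A + 1) / (2 * ?B)"] by (cases "?B = 0") (auto simp: field_simps)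
    then show ?thesis using True by simp
  next
    case False
    with C have C0: "0 < ?C" by linarith
    have "0 \<le> ?A - ?B\<^sup>2 / ?C"
      using q[of "?B / ?C"] C0 by (simp add: power2_eq_square field_simps)
    then show ?thesis using C0 by (simp add: field_simps)
  qed
qed

lemma zero_if_square_small:
  fixes d C :: real
  assumes "\<And>e. 0 < e \<Longrightarrow> d\<^sup>2 \<le> C * e"
  shows "d = 0"
proof (rule ccontr)
  assume "d \<noteq> 0"
  then have d: "0 < d\<^sup>2" by simp
  have "d\<^sup>2 \<le> C * (d\<^sup>2 / (2 * (\<bar>C\<bar> + 1)))" using d by (intro assms) (auto intro!: divide_pos_pos)
  also have "\<dots> \<le> (\<bar>C\<bar> + 1) * (d\<^sup>2 / (2 * (\<bar>C\<bar> + 1)))" by (intro mult_right_mono) auto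
  also have "\<dots> = d\<^sup>2 / 2" by (simp add: field_simps)
  finally show False using d by simp
qed

section \<open>Compactness in finite-dimensional spaces of functions\<close>

definition ortho :: "'a measure \<Rightarrow> ('a \<Rightarrow> complex) set \<Rightarrow> ('a \<Rightarrow> complex) set" where
  "ortho M W = {v \<in> L2 M. \<forall>w\<in>W. (\<integral>x. v x * cnj (w x) \<partial>M) = 0}"

lemma inner_diff_scale:
  assumes "u \<in> L2 M" "v \<in> L2 M" "w \<in> L2 M"
  shows "(\<integral>x. (a * u x - b * v x) * cnj (w x) \<partial>M)
    = a * (\<integral>x. u x * cnj (w x) \<partial>M) - b * (\<integral>x. v x * cnj (w x) \<partial>M)"
proof -
  have "(\<integral>x. (a * u x - b * v x) * cnj (w x) \<partial>M)
    = (\<integral>x. a * (u x * cnj (w x)) - b * (v x * cnj (w x)) \<partial>M)"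
    by (simp add: algebra_simps)
  also have "\<dots> = a * (\<integral>x. u x * cnj (w x) \<partial>M) - b * (\<integral>x. v x * cnj (w x) \<partial>M)"
    using L2_mult_cnj_integrable[OF assms(1,3)] L2_mult_cnj_integrable[OF assms(2,3)] by simp
  finally show ?thesis .
qed

lemma ortho_diff_scale:
  assumes "u \<in> ortho M W" "v \<in> ortho M W" "W \<subseteq> L2 M"
  shows "(\<lambda>x. a * u x - b * v x) \<in> ortho M W"
  using assms inner_diff_scale[of u M v _ a b]
  by (auto simp: ortho_def subset_iff intro!: L2_diff L2_scale)

lemma complex_seq_alternative:
  fixes t :: "nat \<Rightarrow> complex"
  obtains r l where "strict_mono r" "(t \<circ> r) \<longlonglongrightarrow> l"
  | r where "strict_mono r" "\<And>n. real (Suc n) \<le> cmod (t (r n))"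
proof (cases "bounded (range t)")
  case True
  then show ?thesis using bounded_imp_convergent_subsequence that(1) by blast
next
  case False
  have *: "\<exists>k>n. R \<le> cmod (t k)" for n R
  proof (rule ccontr)
    assume "\<not> ?thesis"
    then have "\<forall>k. cmod (t k) \<le> max R (Max ((\<lambda>k. cmod (t k)) ` {..n}))"
      by (metis Max_ge atMost_iff finite_atMost finite_imageI imageI linorder_not_less
          max.coboundedI2 max.coboundedI1 less_imp_le)
    then show False using False by (auto simp: bounded_iff)
  qed
  obtain r where r: "strict_mono r" "\<And>n. real (Suc n) \<le> cmod (t (r n))"
  proof -
    define g where "g n p = (SOME k. k > p \<and> real (Suc n) \<le> cmod (t k))" for n p
    have g: "g n p > p \<and> real (Suc n) \<le> cmod (t (g n p))" for n p
      unfolding g_def by (rule someI_ex) (use * in blast)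
    define r where "r = rec_nat (g 0 0) (\<lambda>n p. g (Suc n) p)"
    have "strict_mono r"
      unfolding strict_mono_Suc_iff r_def using g by simp
    moreover have "real (Suc n) \<le> cmod (t (r n))" for n
    proof (cases n)
      case 0
      then show ?thesis using g[of 0 0] by (simp add: r_def)
    next
      case (Suc m)
      then have "r n = g n (r m)" by (simp add: r_def)
      then show ?thesis using g[where n = n] by metis
    qed
    ultimately show ?thesis using that by blast
  qed
  then show ?thesis using that(2) by blast
qed

text \<open>
  Pairing with the members of the finite set \<open>S\<close> gives injective coordinates on \<open>ortho M W\<close>, which is
  thus finite-dimensional, and the claim is that its \<open>L\<^sup>1\<close>-bounded sequences are relatively
  compact for the \<open>L\<^sup>1\<close> norm. The induction removes one coordinate \<open>s\<close> at a time by adding \<open>s\<close> to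
  \<open>W\<close>. What has to be excluded is that the coordinate is unbounded along an \<open>L\<^sup>1\<close>-bounded
  sequence; this is the usual equivalence of norms in finite dimension, and it comes out of the
  same induction.
\<close>

lemma (in prob_space) finite_dim_L1_compactness:
  assumes "finite S" "S \<subseteq> L2 M" "W \<subseteq> L2 M"
    and "\<And>v. v \<in> ortho M (W \<union> S) \<Longrightarrow> AE x in M. v x = 0"
    and "\<And>n. F n \<in> ortho M W"
    and "\<And>n::nat. (\<integral>x. cmod (F n x) \<partial>M) \<le> C"
  shows "\<exists>r z. strict_mono (r::nat\<Rightarrow>nat) \<and> z \<in> ortho M W \<and>
     (\<lambda>n. \<integral>x. cmod (F (r n) x - z x) \<partial>M) \<longlonglongrightarrow> 0"
  using assms
proof (induction S arbitrary: W F C rule: finite_induct)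
  case empty
  have F: "AE x in M. F n x = 0" for n
    using empty.prems(3)[of "F n"] empty.prems(4)[of n] by simp
  have "(\<integral>x. cmod (F n x - 0) \<partial>M) = 0" for n
    using integral_cong_AE[of "\<lambda>x. cmod (F n x - 0)" M "\<lambda>x. 0"] F[of n]
      empty.prems(4)[of n] by (auto simp: ortho_def L2_def)
  then show ?case
    using strict_mono_id
    by (intro exI[of _ id] exI[of _ "\<lambda>x. 0"]) (auto simp: ortho_def L2_zero strict_mono_id)
next
  case (insert s S)
  let ?I = "\<lambda>v. \<integral>x. v x * cnj (s x) \<partial>M"
  have s: "s \<in> L2 M" using insert.prems by auto
  have sub: "insert s W \<subseteq> L2 M" "S \<subseteq> L2 M" using insert.prems by auto
  have ker: "AE x in M. v x = 0" if "v \<in> ortho M (insert s W \<union> S)" for v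
    using insert.prems(3)[of v] that by simp
  have IH: "\<exists>r z. strict_mono (r::nat\<Rightarrow>nat) \<and> z \<in> ortho M (insert s W) \<and>
     (\<lambda>n. \<integral>x. cmod (G (r n) x - z x) \<partial>M) \<longlonglongrightarrow> 0"
    if "\<And>n. G n \<in> ortho M (insert s W)" "\<And>n::nat. (\<integral>x. cmod (G n x) \<partial>M) \<le> D" for G D
    by (rule insert.IH[OF sub(2,1)]) (erule ker, rule that(1), rule that(2))
  show ?case
  proof (cases "\<forall>v\<in>ortho M W. ?I v = 0")
    case True
    then have "ortho M (insert s W) = ortho M W" by (auto simp: ortho_def)
    with IH[of F C] insert.prems(4,5) show ?thesis by simp
  next
    case False
    then obtain z0 where z0: "z0 \<in> ortho M W" "?I z0 \<noteq> 0" by blast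
    define z where "z = (\<lambda>x. inverse (?I z0) * z0 x - 0 * z0 x)"
    have z: "z \<in> ortho M W" unfolding z_def
      using z0 insert.prems by (intro ortho_diff_scale) auto
    have Iz: "?I z = 1" unfolding z_def
      using inner_diff_scale[of z0 M z0 s "inverse (?I z0)" 0] z0 s by (simp add: ortho_def)
    have L: "z \<in> L2 M" "F n \<in> L2 M" for n using z insert.prems(4) by (auto simp: ortho_def)
    note intF = L2_integrable[OF L(2)] and intz = L2_integrable[OF L(1)]
    define t where "t n = ?I (F n)" for n
    show ?thesis
    proof (cases rule: complex_seq_alternative[of t])
      case (1 r l)
      \<comment> \<open>Subtracting the coordinate leaves a sequence with one coordinate fewer.\<close>
      define G where "G n = (\<lambda>x. 1 * F (r n) x - t (r n) * z x)" for n
      have G: "G n \<in> ortho M (insert s W)" for n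
      proof -
        have "G n \<in> ortho M W" unfolding G_def
          using z insert.prems by (intro ortho_diff_scale) auto
        moreover have "?I (G n) = 0" unfolding G_def
          using inner_diff_scale[OF L(2) L(1) s, of 1 "r n" "t (r n)"] Iz by (simp add: t_def)
        ultimately show ?thesis by (simp add: ortho_def)
      qed
      obtain K where K: "\<And>n. cmod (t (r n)) \<le> K"
        using convergent_imp_bounded[OF 1(2)] by (auto simp: bounded_iff)
      have bound: "(\<integral>x. cmod (G n x) \<partial>M) \<le> C + K * (\<integral>x. cmod (z x) \<partial>M)" for n
      proof -
        have "(\<integral>x. cmod (G n x) \<partial>M) \<le> (\<integral>x. cmod (F (r n) x) + cmod (t (r n)) * cmod (z x) \<partial>M)"
          using intF intz
          by (intro integral_mono) (auto simp: G_def norm_mult intro!: norm_triangle_le_diff)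
        also have "\<dots> = (\<integral>x. cmod (F (r n) x) \<partial>M) + cmod (t (r n)) * (\<integral>x. cmod (z x) \<partial>M)"
          using intF intz by simp
        also have "\<dots> \<le> C + K * (\<integral>x. cmod (z x) \<partial>M)"
          using insert.prems(5) K by (intro add_mono mult_right_mono) auto
        finally show ?thesis .
      qed
      obtain r' g where r': "strict_mono r'" "g \<in> ortho M (insert s W)"
        "(\<lambda>n. \<integral>x. cmod (G (r' n) x - g x) \<partial>M) \<longlonglongrightarrow> 0"
        using IH[of G, OF G bound] by blast
      have gW: "g \<in> ortho M W" using r'(2) by (auto simp: ortho_def)
      then have intg: "integrable M g" by (auto simp: ortho_def intro: L2_integrable)
      define y where "y = (\<lambda>x. 1 * g x - (- l) * z x)"
      have "y \<in> ortho M W" unfolding y_def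
        using z gW insert.prems by (intro ortho_diff_scale) auto
      moreover have "strict_mono (r \<circ> r')" using 1 r' by (intro strict_mono_o)
      moreover have "(\<lambda>n. \<integral>x. cmod (F ((r \<circ> r') n) x - y x) \<partial>M) \<longlonglongrightarrow> 0"
      proof (rule tendsto_sandwich)
        show "\<forall>\<^sub>F n in sequentially. 0 \<le> (\<integral>x. cmod (F ((r \<circ> r') n) x - y x) \<partial>M)" by simp
        show "\<forall>\<^sub>F n in sequentially. (\<integral>x. cmod (F ((r \<circ> r') n) x - y x) \<partial>M)
          \<le> (\<integral>x. cmod (G (r' n) x - g x) \<partial>M) + cmod (t (r (r' n)) - l) * (\<integral>x. cmod (z x) \<partial>M)"
        proof (intro always_eventually allI)
          fix n
          have "(\<integral>x. cmod (F ((r \<circ> r') n) x - y x) \<partial>M)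
            \<le> (\<integral>x. cmod (G (r' n) x - g x) + cmod (t (r (r' n)) - l) * cmod (z x) \<partial>M)"
          proof (rule integral_mono)
            show "cmod (F ((r \<circ> r') n) x - y x)
              \<le> cmod (G (r' n) x - g x) + cmod (t (r (r' n)) - l) * cmod (z x)" for x
            proof -
              have "F ((r \<circ> r') n) x - y x = (G (r' n) x - g x) + (t (r (r' n)) - l) * z x"
                by (simp add: G_def y_def algebra_simps)
              then show ?thesis by (metis norm_mult norm_triangle_ineq)
            qed
          qed (use intF intz intg in \<open>auto simp: G_def y_def\<close>)
          also have "\<dots> = (\<integral>x. cmod (G (r' n) x - g x) \<partial>M) + cmod (t (r (r' n)) - l) * (\<integral>x. cmod (z x) \<partial>M)"
            using intF intz intg by (simp add: G_def)
          finally show "(\<integral>x. cmod (F ((r \<circ> r') n) x - y x) \<partial>M)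
            \<le> (\<integral>x. cmod (G (r' n) x - g x) \<partial>M) + cmod (t (r (r' n)) - l) * (\<integral>x. cmod (z x) \<partial>M)" .
        qed
        have "(\<lambda>n. t (r (r' n)) - l) \<longlonglongrightarrow> 0"
          using LIMSEQ_subseq_LIMSEQ[OF 1(2) r'(1)] by (simp add: o_def LIM_zero_iff)
        then have "(\<lambda>n. cmod (t (r (r' n)) - l)) \<longlonglongrightarrow> 0"
          by (rule tendsto_norm_zero)
        from tendsto_add[OF r'(3) tendsto_mult_right[OF this]]
        show "(\<lambda>n. (\<integral>x. cmod (G (r' n) x - g x) \<partial>M) + cmod (t (r (r' n)) - l) * (\<integral>x. cmod (z x) \<partial>M)) \<longlonglongrightarrow> 0"
          by simp
      qed simp
      ultimately show ?thesis by blast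
    next
      case (2 r)
      \<comment> \<open>Dividing \<open>F (r n)\<close> by its coordinate makes it small in \<open>L\<^sup>1\<close>; so \<open>- z\<close> is an \<open>L\<^sup>1\<close>
          limit of elements whose coordinate is 0, although its own coordinate is \<open>- 1\<close>.\<close>
      have tn: "t (r n) \<noteq> 0" for n using 2(2)[of n] by auto
      define G where "G n = (\<lambda>x. inverse (t (r n)) * F (r n) x - 1 * z x)" for n
      have G: "G n \<in> ortho M (insert s W)" for n
      proof -
        have "G n \<in> ortho M W" unfolding G_def
          using z insert.prems by (intro ortho_diff_scale) auto
        moreover have "?I (G n) = 0" unfolding G_def
          using inner_diff_scale[OF L(2) L(1) s, of "inverse (t (r n))" "r n" 1] Iz tn[of n] by (simp add: t_def)
        ultimately show ?thesis by (simp add: ortho_def)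
      qed
      have C: "0 \<le> C" using insert.prems(5)[of 0] by (rule order_trans[rotated]) simp
      have small: "(\<integral>x. cmod (inverse (t (r n)) * F (r n) x) \<partial>M) \<le> C / real (Suc n)" for n
      proof -
        have "(\<integral>x. cmod (inverse (t (r n)) * F (r n) x) \<partial>M) = inverse (cmod (t (r n))) * (\<integral>x. cmod (F (r n) x) \<partial>M)"
          by (simp add: norm_mult norm_inverse)
        also have "\<dots> \<le> inverse (real (Suc n)) * C"
          using 2(2)[of n] insert.prems(5) C by (intro mult_mono le_imp_inverse_le) auto
        finally show ?thesis by (simp add: field_simps)
      qed
      have bound: "(\<integral>x. cmod (G n x) \<partial>M) \<le> C + (\<integral>x. cmod (z x) \<partial>M)" for n
      proof -
        have "(\<integral>x. cmod (G n x) \<partial>M) \<le> (\<integral>x. cmod (inverse (t (r n)) * F (r n) x) + cmod (z x) \<partial>M)"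
          using intF intz
          by (intro integral_mono) (auto simp: G_def intro!: norm_triangle_ineq4)
        also have "\<dots> = (\<integral>x. cmod (inverse (t (r n)) * F (r n) x) \<partial>M) + (\<integral>x. cmod (z x) \<partial>M)"
          using intF intz by (intro Bochner_Integration.integral_add) auto
        also have "\<dots> \<le> C / real (Suc n) + (\<integral>x. cmod (z x) \<partial>M)"
          using small by simp
        also have "\<dots> \<le> C + (\<integral>x. cmod (z x) \<partial>M)"
          using C by (simp add: divide_le_eq mult_le_cancel_left1)
        finally show ?thesis .
      qed
      obtain r' g where r': "strict_mono r'" "g \<in> ortho M (insert s W)"
        "(\<lambda>n. \<integral>x. cmod (G (r' n) x - g x) \<partial>M) \<longlonglongrightarrow> 0"
        using IH[of G, OF G bound] by blast
      have gL: "g \<in> L2 M" using r'(2) by (auto simp: ortho_def)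
      have intg: "integrable M g" by (rule L2_integrable[OF gL])
      have le: "(\<integral>x. cmod (g x + z x) \<partial>M) \<le> (\<integral>x. cmod (G (r' n) x - g x) \<partial>M) + C / real (Suc (r' n))" for n
      proof -
        have "(\<integral>x. cmod (g x + z x) \<partial>M)
          \<le> (\<integral>x. cmod (G (r' n) x - g x) + cmod (inverse (t (r (r' n))) * F (r (r' n)) x) \<partial>M)"
        proof (rule integral_mono)
          show "cmod (g x + z x) \<le> cmod (G (r' n) x - g x) + cmod (inverse (t (r (r' n))) * F (r (r' n)) x)" for x
          proof -
            have "g x + z x = inverse (t (r (r' n))) * F (r (r' n)) x - (G (r' n) x - g x)"
              by (simp add: G_def)
            then show ?thesis by (metis add.commute norm_triangle_ineq4)
          qed
        qed (use intF intz intg in \<open>auto simp: G_def\<close>)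
        also have "\<dots> = (\<integral>x. cmod (G (r' n) x - g x) \<partial>M) + (\<integral>x. cmod (inverse (t (r (r' n))) * F (r (r' n)) x) \<partial>M)"
          using intF intz intg by (intro Bochner_Integration.integral_add) (auto simp: G_def)
        finally show ?thesis using small[of "r' n"] by linarith
      qed
      have "(\<lambda>n. C / real (Suc n)) \<longlonglongrightarrow> 0"
        using LIMSEQ_Suc[OF lim_const_over_n[of C]] by simp
      from tendsto_add[OF r'(3) LIMSEQ_subseq_LIMSEQ[OF this r'(1)]]
      have "(\<lambda>n. (\<integral>x. cmod (G (r' n) x - g x) \<partial>M) + C / real (Suc (r' n))) \<longlonglongrightarrow> 0"
        by (simp add: o_def)
      from LIMSEQ_le_const[OF this] le have "(\<integral>x. cmod (g x + z x) \<partial>M) \<le> 0" by blast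
      then have "(\<integral>x. cmod (g x + z x) \<partial>M) = 0" by (simp add: order_antisym)
      then have ae: "AE x in M. g x + z x = 0"
        using integral_nonneg_eq_0_iff_AE[of M "\<lambda>x. cmod (g x + z x)"] intg intz by simp
      have "?I (\<lambda>x. 1 * g x - (-1) * z x) = 1"
        using inner_diff_scale[OF gL L(1) s, of 1 "-1"] Iz r'(2) by (simp add: ortho_def)
      moreover have "?I (\<lambda>x. 1 * g x - (-1) * z x) = (\<integral>x. 0 \<partial>M)"
        using ae gL L(1) s by (intro integral_cong_AE) (auto simp: L2_def)
      ultimately show ?thesis by simp
    qed
  qed
qed

section \<open>Strong convergence from convergence in weighted \<open>L\<^sup>1\<close>\<close>

text \<open>
  The part of \<open>\<bar>z\<bar>\<^sup>2\<close> above level \<open>R\<close>; that these parts have uniformly small integrals along a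
  sequence of functions says that their squares are uniformly integrable.
\<close>

definition tail :: "real \<Rightarrow> complex \<Rightarrow> real" where
  "tail R z = (if R < cmod z then (cmod z)\<^sup>2 else 0)"

lemma tail_nonneg: "0 \<le> tail R z"
  by (simp add: tail_def)

lemma tail_measurable [measurable]:
  assumes [measurable]: "u \<in> borel_measurable M"
  shows "(\<lambda>x. tail R (u x)) \<in> borel_measurable M"
  unfolding tail_def by measurable

lemma tail_integrable:
  assumes "u \<in> L2 M"
  shows "integrable M (\<lambda>x. tail R (u x))"
proof (rule Bochner_Integration.integrable_bound[OF L2_square_integrable[OF assms]])
  show "(\<lambda>x. tail R (u x)) \<in> borel_measurable M"
    using L2_measurable[OF assms] by measurable
qed (auto simp: tail_def)

lemma tail_integral_tendsto_0:
  assumes "u \<in> L2 M"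
  shows "(\<lambda>n. \<integral>x. tail (real n) (u x) \<partial>M) \<longlonglongrightarrow> 0"
proof -
  have "(\<lambda>n. \<integral>x. tail (real n) (u x) \<partial>M) \<longlonglongrightarrow> (\<integral>x. 0 \<partial>M)"
  proof (rule integral_dominated_convergence[where w = "\<lambda>x. (cmod (u x))\<^sup>2"])
    show "AE x in M. (\<lambda>n. tail (real n) (u x)) \<longlonglongrightarrow> 0"
    proof (rule AE_I2)
      fix x
      obtain N where "cmod (u x) \<le> real N" using real_arch_simple by blast
      then have "\<forall>n\<ge>N. tail (real n) (u x) = 0" by (auto simp: tail_def)
      then show "(\<lambda>n. tail (real n) (u x)) \<longlonglongrightarrow> 0"
        by (intro tendsto_eventually) (auto simp: eventually_sequentially)
    qed
  qed (use L2_measurable[OF assms] L2_square_integrable[OF assms] in \<open>auto simp: tail_def intro: tail_measurable\<close>)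
  then show ?thesis by simp
qed

text \<open>
  If \<open>a\<close> or \<open>b\<close> exceeds \<open>R\<close>, the tails dominate. Otherwise \<open>\<bar>a - b\<bar> \<le> 2 R\<close>, and either all of the
  first weights \<open>P k\<close> are small, or one of them is large enough to control \<open>\<bar>a - b\<bar>\<close>.
\<close>

lemma square_diff_le_tails:
  fixes P :: "nat \<Rightarrow> complex"
  assumes R: "0 < R"
  shows "(cmod (a - b))\<^sup>2 \<le> 4 * tail R a + 4 * tail R b
    + 4 * R\<^sup>2 * of_bool (\<forall>k\<le>K. cmod (P k) \<le> 1 / real (Suc K))
    + 2 * R * real (Suc K) * (\<Sum>k\<le>K. cmod (P k * (a - b)))"
    (is "_ \<le> ?ta + ?tb + ?ind + ?s")
proof -
  have nn: "0 \<le> ?ta" "0 \<le> ?tb" "0 \<le> ?ind" "0 \<le> ?s"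
    using R by (auto simp: tail_nonneg intro!: mult_nonneg_nonneg sum_nonneg)
  have tri: "cmod (a - b) \<le> cmod a + cmod b" by (rule norm_triangle_ineq4)
  consider "R < cmod a \<or> R < cmod b" | "cmod a \<le> R" "cmod b \<le> R" by linarith
  then show ?thesis
  proof cases
    case 1
    have "(cmod (a - b))\<^sup>2 \<le> ?ta + ?tb"
    proof (cases "cmod b \<le> cmod a")
      case True
      then have "(cmod (a - b))\<^sup>2 \<le> (2 * cmod a)\<^sup>2" using tri by (intro power_mono) auto
      moreover have "tail R a = (cmod a)\<^sup>2" using 1 True by (auto simp: tail_def)
      ultimately show ?thesis using nn(2) by (simp add: power_mult_distrib)
    next
      case False
      then have "(cmod (a - b))\<^sup>2 \<le> (2 * cmod b)\<^sup>2" using tri by (intro power_mono) auto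
      moreover have "tail R b = (cmod b)\<^sup>2" using 1 False by (auto simp: tail_def)
      ultimately show ?thesis using nn(1) by (simp add: power_mult_distrib)
    qed
    then show ?thesis using nn by linarith
  next
    case 2
    then have ab: "cmod (a - b) \<le> 2 * R" using tri by linarith
    show ?thesis
    proof (cases "\<forall>k\<le>K. cmod (P k) \<le> 1 / real (Suc K)")
      case True
      have "(cmod (a - b))\<^sup>2 \<le> (2 * R)\<^sup>2" using ab by (intro power_mono) auto
      also have "\<dots> = ?ind" using True by (simp add: power_mult_distrib)
      finally show ?thesis using nn by linarith
    next
      case False
      then obtain k where k: "k \<le> K" "1 / real (Suc K) < cmod (P k)" by force
      have "(cmod (a - b))\<^sup>2 \<le> 2 * R * cmod (a - b)"
        unfolding power2_eq_square using ab by (intro mult_right_mono) auto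
      also have "\<dots> \<le> 2 * R * ((real (Suc K) * cmod (P k)) * cmod (a - b))"
      proof (rule mult_left_mono)
        have "1 \<le> real (Suc K) * cmod (P k)" using k by (simp add: field_simps)
        from mult_right_mono[OF this norm_ge_zero[of "a - b"]]
        show "cmod (a - b) \<le> (real (Suc K) * cmod (P k)) * cmod (a - b)" by simp
      qed (use R in simp)
      also have "\<dots> = 2 * R * real (Suc K) * cmod (P k * (a - b))"
        by (simp add: norm_mult)
      also have "\<dots> \<le> ?s"
        using k R by (intro mult_left_mono member_le_sum) auto
      finally show ?thesis using nn by linarith
    qed
  qed
qed

text \<open>
  The weights \<open>P k\<close> have no common zero, so the set where \<open>P 0, \<dots>, P K\<close> are all at most \<open>1 / (K + 1)\<close>
  decreases to a null set as \<open>K\<close> grows. Off this set the weighted hypotheses give convergence in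
  measure, and uniform integrability turns it into convergence in \<open>L\<^sup>2\<close>.
\<close>

lemma (in prob_space) L2_Cauchy_from_weighted_L1:
  fixes g P :: "nat \<Rightarrow> 'a \<Rightarrow> complex"
  assumes g: "\<And>i. g i \<in> L2 M" and P: "\<And>k. P k \<in> L2 M"
    and ui: "\<And>e. 0 < e \<Longrightarrow> \<exists>R>0. \<forall>i. (\<integral>x. tail R (g i x) \<partial>M) < e"
    and nz: "AE x in M. \<exists>k. P k x \<noteq> 0"
    and cau: "\<And>k e. 0 < e \<Longrightarrow> \<exists>N. \<forall>i\<ge>N. \<forall>j\<ge>N. (\<integral>x. cmod (P k x * (g i x - g j x)) \<partial>M) < e"
    and e: "0 < e"
  shows "\<exists>N. \<forall>i\<ge>N. \<forall>j\<ge>N. (\<integral>x. (cmod (g i x - g j x))\<^sup>2 \<partial>M) < e"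
proof -
  obtain R where R: "0 < R" "\<And>i. (\<integral>x. tail R (g i x) \<partial>M) < e / 16"
    using ui[of "e / 16"] e by auto
  define B where "B K = {x \<in> space M. \<forall>k\<le>K. cmod (P k x) \<le> 1 / real (Suc K)}" for K
  have Pm [measurable]: "P k \<in> borel_measurable M" for k by (rule L2_measurable[OF P])
  have B [measurable]: "B K \<in> sets M" for K unfolding B_def by measurable
  have "(\<lambda>K. measure M (B K)) \<longlonglongrightarrow> measure M (\<Inter>K. B K)"
  proof (rule finite_Lim_measure_decseq)
    show "decseq B"
    proof (rule decseq_SucI)
      fix K
      have "1 / real (Suc (Suc K)) \<le> 1 / real (Suc K)" by (simp add: field_simps)
      then show "B (Suc K) \<subseteq> B K"
        unfolding B_def by (safe) (meson le_SucI order_trans)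
    qed
  qed auto
  moreover have "measure M (\<Inter>K. B K) = 0"
  proof -
    have "x \<notin> (\<Inter>K. B K)" if Pkx: "P k x \<noteq> 0" for x k
    proof
      assume x: "x \<in> (\<Inter>K. B K)"
      obtain n where n: "1 / real (Suc n) < cmod (P k x)"
        using reals_Archimedean[of "cmod (P k x)"] Pkx by (auto simp: inverse_eq_divide)
      have "cmod (P k x) \<le> 1 / real (Suc (max n k))" using x by (auto simp: B_def)
      also have "\<dots> \<le> 1 / real (Suc n)" by (intro divide_left_mono) auto
      finally show False using n by simp
    qed
    then have "AE x in M. x \<notin> (\<Inter>K. B K)" using nz by (auto elim: eventually_mono)
    then show ?thesis by (subst measure_eq_0_null_sets) (auto simp: AE_iff_null_sets)
  qed
  ultimately have "(\<lambda>K. measure M (B K)) \<longlonglongrightarrow> 0" by simp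
  moreover have "0 < e / (16 * R\<^sup>2)" using e R by simp
  ultimately have "\<forall>\<^sub>F K in sequentially. measure M (B K) < e / (16 * R\<^sup>2)"
    by (rule order_tendstoD)
  then obtain K where "measure M (B K) < e / (16 * R\<^sup>2)"
    by (auto simp: eventually_sequentially)
  then have K: "4 * R\<^sup>2 * measure M (B K) < e / 4" using R by (simp add: field_simps)
  define c where "c = 2 * R * real (Suc K)"
  have c: "0 < c" using R by (simp add: c_def)
  define d where "d = e / (4 * c * real (Suc K))"
  have d: "0 < d" using e c by (simp add: d_def)
  have "\<exists>N. \<forall>k. \<forall>i\<ge>N k. \<forall>j\<ge>N k. (\<integral>x. cmod (P k x * (g i x - g j x)) \<partial>M) < d"
    using cau[OF d] by (intro choice) blast
  then obtain N where N: "\<And>k i j. N k \<le> i \<Longrightarrow> N k \<le> j \<Longrightarrow>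
      (\<integral>x. cmod (P k x * (g i x - g j x)) \<partial>M) < d" by blast
  show ?thesis
  proof (intro exI[of _ "Max (N ` {..K})"] allI impI)
    fix i j assume ij: "Max (N ` {..K}) \<le> i" "Max (N ` {..K}) \<le> j"
    have int: "integrable M (\<lambda>x. cmod (P k x * (g i x - g j x)))" for k
      by (intro Bochner_Integration.integrable_norm L2_mult_integrable L2_diff g P)
    have "(\<integral>x. (cmod (g i x - g j x))\<^sup>2 \<partial>M) \<le> (\<integral>x. 4 * tail R (g i x) + 4 * tail R (g j x)
      + 4 * R\<^sup>2 * indicator (B K) x + c * (\<Sum>k\<le>K. cmod (P k x * (g i x - g j x))) \<partial>M)"
    proof (rule integral_mono)
      show "integrable M (\<lambda>x. (cmod (g i x - g j x))\<^sup>2)"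
        by (intro L2_square_integrable L2_diff g)
      show "integrable M (\<lambda>x. 4 * tail R (g i x) + 4 * tail R (g j x)
        + 4 * R\<^sup>2 * indicator (B K) x + c * (\<Sum>k\<le>K. cmod (P k x * (g i x - g j x))))"
        using int by (intro Bochner_Integration.integrable_add integrable_mult_right tail_integrable g
            Bochner_Integration.integrable_sum) (auto simp: integrable_indicator_iff emeasure_eq_measure)
      fix x assume "x \<in> space M"
      then show "(cmod (g i x - g j x))\<^sup>2 \<le> 4 * tail R (g i x) + 4 * tail R (g j x)
        + 4 * R\<^sup>2 * indicator (B K) x + c * (\<Sum>k\<le>K. cmod (P k x * (g i x - g j x)))"
        using square_diff_le_tails[OF R(1), of "g i x" "g j x" K "\<lambda>k. P k x"]
        by (simp add: B_def c_def indicator_def)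
    qed
    also have "\<dots> = 4 * (\<integral>x. tail R (g i x) \<partial>M) + 4 * (\<integral>x. tail R (g j x) \<partial>M)
      + 4 * R\<^sup>2 * measure M (B K) + c * (\<Sum>k\<le>K. \<integral>x. cmod (P k x * (g i x - g j x)) \<partial>M)"
    proof -
      have "(\<integral>x. 4 * a x + 4 * b x + 4 * R\<^sup>2 * indicator (B K) x + c * (\<Sum>k\<le>K. w k x) \<partial>M)
        = 4 * (\<integral>x. a x \<partial>M) + 4 * (\<integral>x. b x \<partial>M) + 4 * R\<^sup>2 * measure M (B K)
          + c * (\<Sum>k\<le>K. \<integral>x. w k x \<partial>M)"
        if [simp]: "integrable M a" "integrable M b" "\<And>k. integrable M (w k)"
        for a b :: "'a \<Rightarrow> real" and w
      proof -
        have [simp]: "integrable M (indicat_real (B K))"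
          by (simp add: integrable_indicator_iff emeasure_eq_measure)
        show ?thesis by (simp add: Int_absorb2 sets.sets_into_space)
      qed
      from this[of "\<lambda>x. tail R (g i x)" "\<lambda>x. tail R (g j x)" "\<lambda>k x. cmod (P k x * (g i x - g j x))",
          OF tail_integrable[OF g] tail_integrable[OF g] int]
      show ?thesis .
    qed
    also have "\<dots> < 4 * (e / 16) + 4 * (e / 16) + e / 4 + c * (\<Sum>k\<le>K. d)"
    proof (intro add_strict_mono mult_strict_left_mono sum_strict_mono K R c)
      fix k assume "k \<in> {..K}"
      then have "N k \<le> i" "N k \<le> j" using ij by auto
      then show "(\<integral>x. cmod (P k x * (g i x - g j x)) \<partial>M) < d" by (rule N)
    qed auto
    also have "c * (\<Sum>k\<le>K. d) = e / 4"
    proof -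
      have "(\<Sum>k\<le>K. d) = real (Suc K) * d" by simp
      then show ?thesis using c by (simp add: d_def del: of_nat_Suc)
    qed
    finally show "(\<integral>x. (cmod (g i x - g j x))\<^sup>2 \<partial>M) < e" by simp
  qed
qed

section \<open>Orthogonality inside a set of positive measure\<close>

text \<open>
  Two linear equations in three unknowns: the cross product of the coefficient vectors is a solution,
  non-zero unless they are parallel.
\<close>

lemma exists_orthogonal_triple:
  fixes a1 a2 a3 b1 b2 b3 :: complex
  assumes "a1 \<noteq> 0"
  obtains s1 s2 s3 where "(s1, s2, s3) \<noteq> (0, 0, 0)"
    "s1 * a1 + s2 * a2 + s3 * a3 = 0" "s1 * b1 + s2 * b2 + s3 * b3 = 0"
proof (cases "a1 * b2 = a2 * b1")
  case True
  show ?thesis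
  proof (rule that[of "- a2" a1 0])
    show "- a2 * b1 + a1 * b2 + 0 * b3 = 0" using True by simp
  qed (use assms in auto)
next
  case False
  show ?thesis
    by (rule that[of "a2 * b3 - a3 * b2" "a3 * b1 - a1 * b3" "a1 * b2 - a2 * b1"])
      (use False in \<open>auto simp: algebra_simps\<close>)
qed

lemma (in prob_space) nonatomic_split:
  assumes "nonatomic M" "A \<in> sets M" "0 < measure M A"
  obtains B C where "B \<in> sets M" "C \<in> sets M" "B \<inter> C = {}" "B \<union> C = A"
    "0 < measure M B" "0 < measure M C"
proof -
  obtain B where B: "B \<in> sets M" "B \<subseteq> A" "0 < measure M B" "measure M B < measure M A"
    using assms unfolding nonatomic_def emeasure_eq_measure by (auto simp: ennreal_less_iff)
  moreover have "measure M (A - B) = measure M A - measure M B"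
    using B assms by (intro finite_measure_Diff) auto
  ultimately show ?thesis using that[of B "A - B"] assms by auto
qed

text \<open>
  Cut \<open>Y\<close> into three pieces of positive measure: the functions constant on each piece form a
  three-dimensional space, and only two linear conditions are imposed on them.
\<close>

lemma (in prob_space) exists_orthogonal_on_set:
  assumes "nonatomic M" "Y \<in> sets M" "0 < measure M Y" "\<phi> \<in> L2 M"
  obtains u where "u \<in> L2_0 M" "\<And>x. x \<notin> Y \<Longrightarrow> u x = 0" "(\<integral>x. u x * cnj (\<phi> x) \<partial>M) = 0"
    "\<not> (AE x in M. u x = 0)"
proof -
  obtain A B where AB: "A \<in> sets M" "B \<in> sets M" "A \<inter> B = {}" "A \<union> B = Y" "0 < measure M A" "0 < measure M B"
    using nonatomic_split[OF assms(1-3)] by metis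
  obtain C D where CD: "C \<in> sets M" "D \<in> sets M" "C \<inter> D = {}" "C \<union> D = B" "0 < measure M C" "0 < measure M D"
    using nonatomic_split[OF assms(1) AB(2,6)] by metis
  define J where "J Z = (\<integral>x. indicator Z x * cnj (\<phi> x) \<partial>M)" for Z
  obtain s1 s2 s3 where s: "(s1, s2, s3) \<noteq> (0, 0, 0)"
    "s1 * complex_of_real (measure M A) + s2 * complex_of_real (measure M C) + s3 * complex_of_real (measure M D) = 0"
    "s1 * J A + s2 * J C + s3 * J D = 0"
    using exists_orthogonal_triple[of "complex_of_real (measure M A)"] AB(5) by (metis less_irrefl of_real_eq_0_iff)
  let ?i = "\<lambda>Z. indicator Z :: 'a \<Rightarrow> complex"
  define u where "u = (\<lambda>x. s1 * ?i A x + s2 * ?i C x + s3 * ?i D x)"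
  have ind: "?i Z \<in> L2 M" if "Z \<in> sets M" for Z
  proof -
    have "(\<lambda>x. (cmod (?i Z x))\<^sup>2) = indicator Z" by (auto simp: indicator_def)
    then show ?thesis using that
      by (simp add: L2_def integrable_indicator_iff emeasure_eq_measure)
  qed
  have uL: "u \<in> L2 M" unfolding u_def using AB CD by (intro L2_add L2_scale ind)
  have intc: "integrable M (\<lambda>x. ?i Z x * cnj (\<phi> x))" if "Z \<in> sets M" for Z
    by (rule L2_mult_cnj_integrable[OF ind[OF that] assms(4)])
  have mean: "(\<integral>x. ?i Z x \<partial>M) = complex_of_real (measure M Z)" if "Z \<in> sets M" for Z
  proof -
    have "(\<integral>x. ?i Z x \<partial>M) = (\<integral>x. complex_of_real (indicator Z x) \<partial>M)"
      by (rule Bochner_Integration.integral_cong) (auto simp: indicator_def)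
    also have "\<dots> = complex_of_real (measure M (Z \<inter> space M))"
      unfolding integral_complex_of_real by simp
    finally show ?thesis using that by (simp add: Int_absorb2 sets.sets_into_space)
  qed
  have "(\<integral>x. u x \<partial>M) = 0"
    unfolding u_def using s(2) AB CD L2_integrable[OF ind] mean by simp
  moreover have "(\<integral>x. u x * cnj (\<phi> x) \<partial>M) = 0"
  proof -
    have "(\<integral>x. u x * cnj (\<phi> x) \<partial>M)
      = (\<integral>x. s1 * (?i A x * cnj (\<phi> x)) + s2 * (?i C x * cnj (\<phi> x)) + s3 * (?i D x * cnj (\<phi> x)) \<partial>M)"
      by (simp add: u_def algebra_simps)
    also have "\<dots> = s1 * J A + s2 * J C + s3 * J D"
      using intc AB CD by (simp add: J_def)
    finally show ?thesis using s(3) by simp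
  qed
  moreover have "\<not> (AE x in M. u x = 0)"
  proof
    assume ae: "AE x in M. u x = 0"
    have *: "s = 0" if "Z \<in> sets M" "0 < measure M Z" "\<And>x. x \<in> Z \<Longrightarrow> u x = s" for Z s
    proof (rule ccontr)
      assume "s \<noteq> 0"
      with ae that(3) have "AE x in M. x \<notin> Z" by (auto elim!: eventually_mono)
      then have "measure M Z = 0" using that(1) by (simp add: AE_iff_null_sets measure_eq_0_null_sets)
      then show False using that(2) by simp
    qed
    have "s1 = 0" by (rule *[OF AB(1,5)]) (use AB CD in \<open>auto simp: u_def indicator_def\<close>)
    moreover have "s2 = 0" by (rule *[OF CD(1,5)]) (use AB CD in \<open>auto simp: u_def indicator_def\<close>)
    moreover have "s3 = 0" by (rule *[OF CD(2,6)]) (use AB CD in \<open>auto simp: u_def indicator_def\<close>)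
    ultimately show False using s(1) by simp
  qed
  moreover have "u x = 0" if "x \<notin> Y" for x using that AB CD by (auto simp: u_def indicator_def)
  ultimately show ?thesis using uL that by (auto simp: L2_0_def)
qed

section \<open>The orbit of a 3-fold Lebesgue generator\<close>

lemma exists_unit_pair:
  fixes a b :: complex
  shows "\<exists>v :: complex \<times> complex. norm v = 1 \<and> fst v * a = snd v * b"
proof (cases "(b, a) = 0")
  case True
  then show ?thesis by (intro exI[of _ "(1, 0)"]) (simp add: norm_Pair zero_prod_def)
next
  case False
  then have "norm ((1 / norm (b, a)) *\<^sub>R (b, a)) = 1" by (simp only: norm_scaleR) simp
  then show ?thesis
    by (intro exI[of _ "(1 / norm (b, a)) *\<^sub>R (b, a)"]) (simp add: mult.commute)
qed

text \<open>
  What the proof uses of the orbit \<open>f n\<close> of a 3-fold Lebesgue generator: orthogonality of products,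
  totality in \<open>L2_0 M\<close>, and those consequences of stationarity that concern single functions and
  differences of two. The aim is to derive a contradiction.
\<close>

locale threefold_orbit = prob_space M for M :: "'a measure" +
  fixes f :: "int \<Rightarrow> 'a \<Rightarrow> complex"
  assumes nonatomic: "nonatomic M"
    and f_L2: "f n \<in> L2 M"
    and f_mean: "(\<integral>x. f n x \<partial>M) = 0"
    and f_nonzero: "\<not> (AE x in M. f 0 x = 0)"
    and mult_L2: "m \<noteq> n \<Longrightarrow> (\<lambda>x. f m x * f n x) \<in> L2 M"
    and mult_ortho: "m \<noteq> n \<Longrightarrow> j \<noteq> m \<Longrightarrow> j \<noteq> n \<Longrightarrow> (\<integral>x. f m x * f n x * cnj (f j x) \<partial>M) = 0"
    and complete: "u \<in> L2_0 M \<Longrightarrow> (\<And>j. (\<integral>x. u x * cnj (f j x) \<partial>M) = 0) \<Longrightarrow> AE x in M. u x = 0"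
    and dist_shift: "(\<integral>x. (cmod (f (m + k) x - f (n + k) x))\<^sup>2 \<partial>M) = (\<integral>x. (cmod (f m x - f n x))\<^sup>2 \<partial>M)"
    and norm_shift: "(\<integral>x. (cmod (f n x))\<^sup>2 \<partial>M) = (\<integral>x. (cmod (f 0 x))\<^sup>2 \<partial>M)"
    and tail_shift: "(\<integral>x. tail R (f n x) \<partial>M) = (\<integral>x. tail R (f 0 x) \<partial>M)"
begin

abbreviation "f_norm_sq \<equiv> (\<integral>x. (cmod (f 0 x))\<^sup>2 \<partial>M)"

lemma f_measurable [measurable]: "f n \<in> borel_measurable M"
  by (rule L2_measurable[OF f_L2])

text \<open>
  On a set of positive measure where the orbit is proportional to a single function \<open>\<phi>\<close>, a function
  living on that set need only be orthogonal to \<open>\<phi>\<close> to be orthogonal to the whole orbit, so totality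
  fails.
\<close>

lemma not_proportional_on_set:
  assumes "Y \<in> sets M" "0 < measure M Y" "\<phi> \<in> L2 M"
    and multiple: "\<And>m. AE x in M. x \<in> Y \<longrightarrow> f m x = c m * \<phi> x"
  shows False
proof -
  obtain u where u: "u \<in> L2_0 M" "\<And>x. x \<notin> Y \<Longrightarrow> u x = 0" "(\<integral>x. u x * cnj (\<phi> x) \<partial>M) = 0"
    "\<not> (AE x in M. u x = 0)"
    using exists_orthogonal_on_set[OF nonatomic assms(1-3)] by blast
  have uL: "u \<in> L2 M" using u(1) by (simp add: L2_0_def)
  have "(\<integral>x. u x * cnj (f j x) \<partial>M) = 0" for j
  proof -
    have "(\<integral>x. u x * cnj (f j x) \<partial>M) = (\<integral>x. cnj (c j) * (u x * cnj (\<phi> x)) \<partial>M)"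
    proof (rule integral_cong_AE)
      show "AE x in M. u x * cnj (f j x) = cnj (c j) * (u x * cnj (\<phi> x))"
        using multiple[of j] by eventually_elim (use u(2) in auto)
    qed (use L2_mult_cnj_integrable[OF uL f_L2] L2_mult_cnj_integrable[OF uL assms(3)] in auto)
    then show ?thesis using u(3) by simp
  qed
  then show False using complete[OF u(1)] u(4) by blast
qed

lemma integral_mult_le: "(\<integral>x. cmod (f m x) * cmod (f n x) \<partial>M) \<le> f_norm_sq"
proof (rule power2_le_imp_le)
  show "(\<integral>x. cmod (f m x) * cmod (f n x) \<partial>M)\<^sup>2 \<le> f_norm_sq\<^sup>2"
    using L2_Cauchy_Schwarz[OF f_L2 f_L2, of m n] norm_shift[of m] norm_shift[of n]
    by (simp add: power2_eq_square)
qed simp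

text \<open>
  The key step. The coefficients \<open>v i\<close> are chosen so that the only product not covered by
  \<open>mult_ortho\<close>, namely the one with \<open>f (n i)\<close> itself, also vanishes. This places all
  \<open>F i\<close> in one and the same space \<open>ortho M W\<close>, on which the mean and the pairings with \<open>f m\<close> and \<open>f l\<close>
  are injective coordinates. Normalising \<open>v i\<close> bounds \<open>F i\<close> in \<open>L\<^sup>1\<close> and lets \<open>v i\<close> converge to
  a pair that is still non-zero.
\<close>

lemma pair_subsequence:
  fixes s :: "nat \<Rightarrow> nat"
  assumes ml: "m \<noteq> l" and s: "strict_mono s"
  obtains r p q z where "strict_mono r" "(p, q) \<noteq> (0, 0)" "z \<in> L2 M"
    "(\<lambda>i. \<integral>x. cmod (f (int (s (r i))) x * (p * f m x - q * f l x) - z x) \<partial>M) \<longlonglongrightarrow> 0"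
proof -
  \<comment> \<open>The shift by \<open>K\<close> keeps the times \<open>n i\<close> away from \<open>m\<close> and \<open>l\<close>.\<close>
  define K where "K = nat (max m l) + 1"
  define n where "n i = int (s (i + K))" for i
  have n: "n i \<noteq> m" "n i \<noteq> l" for i
  proof -
    have "i + K \<le> s (i + K)" by (rule seq_suble[OF s])
    then show "n i \<noteq> m" "n i \<noteq> l" by (auto simp: n_def K_def)
  qed
  let ?I = "\<lambda>i k. \<integral>x. (f k x * f (n i) x) * cnj (f (n i) x) \<partial>M"
  have "\<forall>i. \<exists>v :: complex \<times> complex. norm v = 1 \<and> fst v * ?I i m = snd v * ?I i l"
    by (rule allI, rule exists_unit_pair)
  from choice[OF this] obtain v :: "nat \<Rightarrow> complex \<times> complex" where v: "\<And>i. norm (v i) = 1"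
    "\<And>i. fst (v i) * ?I i m = snd (v i) * ?I i l" by auto
  define F where "F i = (\<lambda>x. fst (v i) * (f m x * f (n i) x) - snd (v i) * (f l x * f (n i) x))" for i
  define W where "W = f ` (- {m, l})"
  define S where "S = {(\<lambda>x. 1), f m, f l}"
  have L: "(\<lambda>x. f m x * f (n i) x) \<in> L2 M" "(\<lambda>x. f l x * f (n i) x) \<in> L2 M" for i
    using mult_L2 n[of i] by auto
  have FL: "F i \<in> L2 M" for i unfolding F_def by (intro L2_diff L2_scale L)
  have F: "F i \<in> ortho M W" for i
  proof -
    have "(\<integral>x. F i x * cnj (f j x) \<partial>M) = 0" if j: "j \<noteq> m" "j \<noteq> l" for j
    proof -
      have eq: "(\<integral>x. F i x * cnj (f j x) \<partial>M)
        = fst (v i) * (\<integral>x. (f m x * f (n i) x) * cnj (f j x) \<partial>M)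
          - snd (v i) * (\<integral>x. (f l x * f (n i) x) * cnj (f j x) \<partial>M)"
        unfolding F_def by (rule inner_diff_scale[OF L f_L2])
      show ?thesis
      proof (cases "j = n i")
        case True
        then show ?thesis unfolding eq using v(2)[of i] by simp
      next
        case False
        then show ?thesis unfolding eq using mult_ortho[of m "n i" j] mult_ortho[of l "n i" j] n[of i] j by simp
      qed
    qed
    then show ?thesis using FL by (auto simp: ortho_def W_def)
  qed
  have ker: "AE x in M. u x = 0" if "u \<in> ortho M (W \<union> S)" for u
  proof (rule complete)
    show "u \<in> L2_0 M" using that by (simp add: ortho_def S_def L2_0_def)
    show "(\<integral>x. u x * cnj (f j x) \<partial>M) = 0" for j
      using that by (cases "j \<in> {m, l}") (auto simp: ortho_def S_def W_def)
  qed
  have int: "integrable M (\<lambda>x. cmod (f j x) * cmod (f k x))" for j k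
    by (rule L2_norm_mult_integrable[OF f_L2 f_L2])
  have v1: "cmod (fst (v i)) \<le> 1" "cmod (snd (v i)) \<le> 1" for i
    using v(1)[of i] norm_fst_le[of "fst (v i)" "snd (v i)"] norm_snd_le[of "snd (v i)" "fst (v i)"] by auto
  have B0: "0 \<le> f_norm_sq" by simp
  have comb: "(\<integral>x. cmod (a * (f m x * f j x) - b * (f l x * f j x)) \<partial>M) \<le> cmod a * f_norm_sq + cmod b * f_norm_sq" for a b j
  proof -
    have "(\<integral>x. cmod (a * (f m x * f j x) - b * (f l x * f j x)) \<partial>M)
      \<le> (\<integral>x. cmod a * (cmod (f m x) * cmod (f j x)) + cmod b * (cmod (f l x) * cmod (f j x)) \<partial>M)"
    proof (rule integral_mono)
      show "cmod (a * (f m x * f j x) - b * (f l x * f j x))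
        \<le> cmod a * (cmod (f m x) * cmod (f j x)) + cmod b * (cmod (f l x) * cmod (f j x))" for x
        by (rule order_trans[OF norm_triangle_ineq4]) (simp add: norm_mult)
    qed (use int L2_mult_integrable[OF f_L2 f_L2] in auto)
    also have "\<dots> = cmod a * (\<integral>x. cmod (f m x) * cmod (f j x) \<partial>M) + cmod b * (\<integral>x. cmod (f l x) * cmod (f j x) \<partial>M)"
      using int by simp
    also have "\<dots> \<le> cmod a * f_norm_sq + cmod b * f_norm_sq"
      by (intro add_mono mult_left_mono integral_mult_le) auto
    finally show ?thesis .
  qed
  have bound: "(\<integral>x. cmod (F i x) \<partial>M) \<le> 1 * f_norm_sq + 1 * f_norm_sq" for i
    unfolding F_def by (rule order_trans[OF comb]) (intro add_mono mult_right_mono v1 B0)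
  have "finite S" "S \<subseteq> L2 M" "W \<subseteq> L2 M" using f_L2 L2_const by (auto simp: S_def W_def)
  from finite_dim_L1_compactness[where F = F, OF this ker F bound]
  obtain r1 z where r1: "strict_mono r1" "z \<in> ortho M W"
    "(\<lambda>i. \<integral>x. cmod (F (r1 i) x - z x) \<partial>M) \<longlonglongrightarrow> 0" by blast
  have zL: "z \<in> L2 M" using r1(2) by (simp add: ortho_def)
  have "compact (sphere (0 :: complex \<times> complex) 1)" by simp
  then have "seq_compact (sphere (0 :: complex \<times> complex) 1)" by (simp add: compact_eq_seq_compact_metric)
  moreover have "\<forall>i. (v \<circ> r1) i \<in> sphere 0 1" using v(1) by simp
  ultimately obtain w r2 where r2: "w \<in> sphere 0 1" "strict_mono r2" "((v \<circ> r1) \<circ> r2) \<longlonglongrightarrow> w"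
    by (rule seq_compactE)
  define r where "r i = r1 (r2 i) + K" for i
  have "strict_mono r"
    using strict_mono_o[OF r1(1) r2(2)] by (auto simp: strict_mono_def r_def)
  moreover have "(fst w, snd w) \<noteq> (0, 0)" using r2(1) by (auto simp: zero_prod_def[symmetric])
  moreover have "(\<lambda>i. \<integral>x. cmod (f (int (s (r i))) x * (fst w * f m x - snd w * f l x) - z x) \<partial>M) \<longlonglongrightarrow> 0"
  proof (rule tendsto_sandwich[where f = "\<lambda>_. 0"])
    let ?k = "\<lambda>i. r1 (r2 i)"
    let ?e = "\<lambda>i. (\<integral>x. cmod (F (?k i) x - z x) \<partial>M)
        + (cmod (fst w - fst (v (?k i))) * f_norm_sq + cmod (snd w - snd (v (?k i))) * f_norm_sq)"
    show "\<forall>\<^sub>F i in sequentially. (\<integral>x. cmod (f (int (s (r i))) x * (fst w * f m x - snd w * f l x) - z x) \<partial>M) \<le> ?e i"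
    proof (intro always_eventually allI)
      fix i
      let ?d = "\<lambda>x. (fst w - fst (v (?k i))) * (f m x * f (n (?k i)) x) - (snd w - snd (v (?k i))) * (f l x * f (n (?k i)) x)"
      have dint: "integrable M ?d"
        using L2_mult_integrable[OF f_L2 f_L2] by auto
      have Fz: "integrable M (\<lambda>x. F (?k i) x - z x)"
        by (intro L2_integrable L2_diff FL zL)
      have eq: "f (int (s (r i))) x * (fst w * f m x - snd w * f l x) - z x = (F (?k i) x - z x) + ?d x" for x
        by (simp add: F_def n_def r_def algebra_simps)
      have "(\<integral>x. cmod (f (int (s (r i))) x * (fst w * f m x - snd w * f l x) - z x) \<partial>M)
        \<le> (\<integral>x. cmod (F (?k i) x - z x) + cmod (?d x) \<partial>M)"
        unfolding eq using dint Fz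
        by (intro integral_mono norm_triangle_ineq Bochner_Integration.integrable_add
            Bochner_Integration.integrable_norm)
      also have "\<dots> = (\<integral>x. cmod (F (?k i) x - z x) \<partial>M) + (\<integral>x. cmod (?d x) \<partial>M)"
        using dint Fz by (intro Bochner_Integration.integral_add Bochner_Integration.integrable_norm)
      also have "\<dots> \<le> ?e i" using comb by (intro add_left_mono)
      finally show "(\<integral>x. cmod (f (int (s (r i))) x * (fst w * f m x - snd w * f l x) - z x) \<partial>M) \<le> ?e i" .
    qed
    have vw: "(\<lambda>i. v (?k i)) \<longlonglongrightarrow> w" using r2(3) by (simp add: o_def)
    have "(\<lambda>i. fst w - fst (v (?k i))) \<longlonglongrightarrow> fst w - fst w" "(\<lambda>i. snd w - snd (v (?k i))) \<longlonglongrightarrow> snd w - snd w"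
      by (intro tendsto_intros vw)+
    then have c: "(\<lambda>i. cmod (fst w - fst (v (?k i)))) \<longlonglongrightarrow> 0" "(\<lambda>i. cmod (snd w - snd (v (?k i)))) \<longlonglongrightarrow> 0"
      by (auto intro: tendsto_norm_zero)
    have a: "(\<lambda>i. \<integral>x. cmod (F (?k i) x - z x) \<partial>M) \<longlonglongrightarrow> 0"
      using LIMSEQ_subseq_LIMSEQ[OF r1(3) r2(2)] by (simp add: o_def)
    show "?e \<longlonglongrightarrow> 0"
      using tendsto_add[OF a tendsto_add[OF tendsto_mult_right[OF c(1), of f_norm_sq] tendsto_mult_right[OF c(2), of f_norm_sq]]]
      by simp
  qed auto
  ultimately show ?thesis using that zL by blast
qed

lemma common_subsequence:
  obtains s :: "nat \<Rightarrow> nat" and p q :: "int \<Rightarrow> int \<Rightarrow> complex" and z :: "int \<Rightarrow> int \<Rightarrow> 'a \<Rightarrow> complex"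
  where "strict_mono s"
    "\<And>m l. m \<noteq> l \<Longrightarrow> (p m l, q m l) \<noteq> (0, 0)"
    "\<And>m l. m \<noteq> l \<Longrightarrow> z m l \<in> L2 M"
    "\<And>m l. m \<noteq> l \<Longrightarrow>
      (\<lambda>i. \<integral>x. cmod (f (int (s i)) x * (p m l * f m x - q m l * f l x) - z m l x) \<partial>M) \<longlonglongrightarrow> 0"
proof -
  define conv where "conv m l p q z s \<longleftrightarrow> (p, q) \<noteq> (0, 0) \<and> z \<in> L2 M \<and>
    (\<lambda>i. \<integral>x. cmod (f (int (s i)) x * (p * f m x - q * f l x) - z x) \<partial>M) \<longlonglongrightarrow> 0"
    for m l p q z and s :: "nat \<Rightarrow> nat"
  define Q where "Q k s \<longleftrightarrow> (case from_nat k of (m, l) \<Rightarrow> m \<noteq> l \<longrightarrow> (\<exists>p q z. conv m l p q z s))"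
    for k :: nat and s :: "nat \<Rightarrow> nat"
  interpret subseqs Q
  proof
    fix k and s :: "nat \<Rightarrow> nat" assume s: "strict_mono s"
    obtain m l :: int where ml: "from_nat k = (m, l)" by fastforce
    show "\<exists>r'. strict_mono r' \<and> Q k (s \<circ> r')"
    proof (cases "m = l")
      case True
      then show ?thesis using strict_mono_id by (auto simp: Q_def ml)
    next
      case False
      obtain r p q z where "strict_mono r" "(p, q) \<noteq> (0, 0)" "z \<in> L2 M"
        "(\<lambda>i. \<integral>x. cmod (f (int (s (r i))) x * (p * f m x - q * f l x) - z x) \<partial>M) \<longlonglongrightarrow> 0"
        by (rule pair_subsequence[OF False s])
      then show ?thesis by (auto simp: Q_def ml conv_def)
    qed
  qed
  have tail: "\<exists>p q z. conv m l p q z diagseq" if ml: "m \<noteq> l" for m l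
  proof -
    define k where "k = to_nat (m, l)"
    have "Q k (diagseq \<circ> (+) (Suc k))"
    proof (rule diagseq_holds)
      fix r s :: "nat \<Rightarrow> nat" and n assume r: "strict_mono r" and Q: "Q n s"
      have "conv m l p q z (s \<circ> r)" if "conv m l p q z s" for m l p q z
        using that LIMSEQ_subseq_LIMSEQ[OF _ r] by (fastforce simp: conv_def o_def)
      moreover obtain m l :: int where ml: "from_nat n = (m, l)" by fastforce
      ultimately show "Q n (s \<circ> r)" using Q by (simp add: Q_def ml) blast
    qed
    then obtain p q z where c: "conv m l p q z (diagseq \<circ> (+) (Suc k))"
      using ml by (auto simp: Q_def k_def)
    have "conv m l p q z diagseq"
      using c LIMSEQ_offset[of "\<lambda>i. \<integral>x. cmod (f (int (diagseq i)) x * (p * f m x - q * f l x) - z x) \<partial>M" "Suc k" 0]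
      by (simp add: conv_def add.commute)
    then show ?thesis by blast
  qed
  have "\<forall>m l. \<exists>p q z. m \<noteq> l \<longrightarrow> conv m l p q z diagseq" using tail by blast
  then obtain p q z where pqz: "\<And>m l. m \<noteq> l \<Longrightarrow> conv m l (p m l) (q m l) (z m l) diagseq"
    unfolding choice_iff by blast
  show ?thesis
    by (rule that[OF subseq_diagseq, of p q z]) (use pqz in \<open>auto simp: conv_def\<close>)
qed

text \<open>
  Where all these combinations vanish, either the whole orbit vanishes or every \<open>f m\<close> is a fixed
  multiple of one \<open>f k\<close>; the factors do not depend on the point because \<open>p\<close> and \<open>q\<close> do not.
\<close>

lemma AE_not_proportional:
  assumes pq: "\<And>m l. m \<noteq> l \<Longrightarrow> (p m l, q m l) \<noteq> (0 :: complex, 0 :: complex)"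
  shows "AE x in M. \<exists>m l. m \<noteq> l \<and> p m l * f m x - q m l * f l x \<noteq> 0"
proof -
  define Y where "Y = {x \<in> space M. \<forall>m l. m \<noteq> l \<longrightarrow> p m l * f m x - q m l * f l x = 0}"
  have Y: "Y \<in> sets M" unfolding Y_def by measurable
  have YD: "p m l * f m x = q m l * f l x" if "x \<in> Y" "m \<noteq> l" for x m l
    using that by (auto simp: Y_def)
  have "measure M Y = 0"
  proof (rule ccontr)
    assume "measure M Y \<noteq> 0"
    then have pos: "0 < measure M Y" by (simp add: zero_less_measure_iff)
    show False
    proof (cases "\<exists>k. \<exists>x\<in>Y. f k x \<noteq> 0")
      case True
      then obtain k y where k: "y \<in> Y" "f k y \<noteq> 0" by blast
      have q: "q k m \<noteq> 0" if "m \<noteq> k" for m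
        using YD[OF k(1), of k m] pq[of k m] k(2) that by auto
      define c where "c m = (if m = k then 1 else p k m / q k m)" for m
      have "f m x = c m * f k x" if "x \<in> Y" for m x
        using YD[OF that, of k m] q[of m] by (auto simp: c_def field_simps)
      then show False
        by (intro not_proportional_on_set[OF Y pos f_L2[of k], of c] AE_I2 impI)
    next
      case False
      then show False
        by (intro not_proportional_on_set[OF Y pos L2_zero, of "\<lambda>_. 0"] AE_I2 impI) simp
    qed
  qed
  then have "Y \<in> null_sets M" using Y by (simp add: null_sets_def emeasure_eq_measure)
  then have "AE x in M. x \<notin> Y" by (rule AE_not_in)
  then show ?thesis using AE_space by eventually_elim (auto simp: Y_def)
qed

lemma uniformly_small_tails:
  assumes "0 < e"
  shows "\<exists>R>0. \<forall>n. (\<integral>x. tail R (f n x) \<partial>M) < e"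
proof -
  have "\<forall>\<^sub>F R in sequentially. (\<integral>x. tail (real R) (f 0 x) \<partial>M) < e"
    by (rule order_tendstoD(2)[OF tail_integral_tendsto_0[OF f_L2] assms])
  then have "\<forall>\<^sub>F R in sequentially. (\<integral>x. tail (real R) (f 0 x) \<partial>M) < e \<and> 0 < R"
    using eventually_gt_at_top by (rule eventually_conj)
  then obtain R :: nat where "(\<integral>x. tail (real R) (f 0 x) \<partial>M) < e" "0 < R"
    by (auto simp: eventually_sequentially)
  then have "\<forall>n. (\<integral>x. tail (real R) (f n x) \<partial>M) < e" by (subst tail_shift) simp
  then show ?thesis using \<open>0 < R\<close> by (intro exI[of _ "real R"]) simp
qed

text \<open>
  The limiting combinations \<open>p m l * f m - q m l * f l\<close> serve as weights: they do not vanish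
  simultaneously, and \<open>f (int (s i))\<close> times each of them converges in \<open>L\<^sup>1\<close>.
\<close>

lemma Cauchy_subsequence:
  obtains s :: "nat \<Rightarrow> nat" where "strict_mono s"
    "\<And>e. 0 < e \<Longrightarrow> \<exists>N. \<forall>i\<ge>N. \<forall>j\<ge>N. (\<integral>x. (cmod (f (int (s i)) x - f (int (s j)) x))\<^sup>2 \<partial>M) < e"
proof (rule common_subsequence)
  fix s :: "nat \<Rightarrow> nat" and p q :: "int \<Rightarrow> int \<Rightarrow> complex" and z :: "int \<Rightarrow> int \<Rightarrow> 'a \<Rightarrow> complex"
  assume s: "strict_mono s"
    and pq: "\<And>m l. m \<noteq> l \<Longrightarrow> (p m l, q m l) \<noteq> (0, 0)"
    and z: "\<And>m l. m \<noteq> l \<Longrightarrow> z m l \<in> L2 M"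
    and lim: "\<And>m l. m \<noteq> l \<Longrightarrow>
      (\<lambda>i. \<integral>x. cmod (f (int (s i)) x * (p m l * f m x - q m l * f l x) - z m l x) \<partial>M) \<longlonglongrightarrow> 0"
  define P where "P k = (case from_nat k of (m, l) \<Rightarrow>
      if m = l then (\<lambda>x. 0) else (\<lambda>x. p m l * f m x - q m l * f l x))" for k :: nat
  show ?thesis
  proof (rule that[OF s], rule L2_Cauchy_from_weighted_L1[where P = P])
    show "P k \<in> L2 M" for k
      unfolding P_def by (auto split: prod.split intro!: L2_zero L2_diff L2_scale f_L2)
    show "\<exists>R>0. \<forall>i. (\<integral>x. tail R (f (int (s i)) x) \<partial>M) < e" if "0 < e" for e
      using uniformly_small_tails[OF that] by blast
    show "AE x in M. \<exists>k. P k x \<noteq> 0"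
    proof -
      have "AE x in M. \<exists>m l. m \<noteq> l \<and> p m l * f m x - q m l * f l x \<noteq> 0"
        by (rule AE_not_proportional) (rule pq)
      then show ?thesis
      proof eventually_elim
        case (elim x)
        then obtain m l where "m \<noteq> l" "p m l * f m x - q m l * f l x \<noteq> 0" by blast
        then show ?case by (intro exI[of _ "to_nat (m, l)"]) (simp add: P_def)
      qed
    qed
    fix k and e :: real assume e: "0 < e"
    obtain m l :: int where ml: "from_nat k = (m, l)" by fastforce
    show "\<exists>N. \<forall>i\<ge>N. \<forall>j\<ge>N. (\<integral>x. cmod (P k x * (f (int (s i)) x - f (int (s j)) x)) \<partial>M) < e"
    proof (cases "m = l")
      case True
      then show ?thesis using e by (simp add: P_def ml)
    next
      case False
      let ?D = "\<lambda>i x. f (int (s i)) x * (p m l * f m x - q m l * f l x) - z m l x"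
      have D: "integrable M (?D i)" for i
        by (intro Bochner_Integration.integrable_diff L2_mult_integrable L2_diff L2_scale f_L2
            L2_integrable z False)
      have "\<forall>\<^sub>F i in sequentially. (\<integral>x. cmod (?D i x) \<partial>M) < e / 2"
        by (rule order_tendstoD(2)[OF lim[OF False]]) (use e in simp)
      then obtain N where N: "\<And>i. N \<le> i \<Longrightarrow> (\<integral>x. cmod (?D i x) \<partial>M) < e / 2"
        by (auto simp: eventually_sequentially)
      have "(\<integral>x. cmod (P k x * (f (int (s i)) x - f (int (s j)) x)) \<partial>M) < e" if "N \<le> i" "N \<le> j" for i j
      proof -
        have eq: "P k x * (f (int (s i)) x - f (int (s j)) x) = ?D i x - ?D j x" for x
          using False by (simp add: P_def ml algebra_simps)
        have "(\<integral>x. cmod (P k x * (f (int (s i)) x - f (int (s j)) x)) \<partial>M)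
          \<le> (\<integral>x. cmod (?D i x) + cmod (?D j x) \<partial>M)"
          unfolding eq by (intro integral_mono norm_triangle_ineq4 Bochner_Integration.integrable_add
              Bochner_Integration.integrable_norm Bochner_Integration.integrable_diff D)
        also have "\<dots> = (\<integral>x. cmod (?D i x) \<partial>M) + (\<integral>x. cmod (?D j x) \<partial>M)"
          by (intro Bochner_Integration.integral_add Bochner_Integration.integrable_norm D)
        finally show ?thesis using N[OF that(1)] N[OF that(2)] by linarith
      qed
      then show ?thesis by blast
    qed
  qed (auto intro: f_L2)
qed

section \<open>Rigidity and its consequences\<close>

text \<open>
  The distance of two orbit elements depends only on the difference of their times, so two late and
  widely separated members of the Cauchy subsequence give \<open>k\<close>.
\<close>

lemma orbit_rigid:
  assumes "0 < e"
  shows "\<exists>k\<ge>K. \<forall>a. (\<integral>x. (cmod (f a x - f (a + k) x))\<^sup>2 \<partial>M) < e"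
proof (rule Cauchy_subsequence)
  fix s :: "nat \<Rightarrow> nat"
  assume s: "strict_mono s"
    and cau: "\<And>e. 0 < e \<Longrightarrow> \<exists>N. \<forall>i\<ge>N. \<forall>j\<ge>N. (\<integral>x. (cmod (f (int (s i)) x - f (int (s j)) x))\<^sup>2 \<partial>M) < e"
  obtain N where N: "\<And>i j. N \<le> i \<Longrightarrow> N \<le> j \<Longrightarrow> (\<integral>x. (cmod (f (int (s i)) x - f (int (s j)) x))\<^sup>2 \<partial>M) < e"
    using cau[OF assms] by blast
  define j where "j = N + (s N + nat K)"
  define k where "k = int (s j) - int (s N)"
  have "j \<le> s j" by (rule seq_suble[OF s])
  then have "K \<le> k" by (simp add: k_def j_def)
  moreover have "(\<integral>x. (cmod (f a x - f (a + k) x))\<^sup>2 \<partial>M) < e" for a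
    using N[of N j] dist_shift[of "int (s N)" "a - int (s N)" "int (s j)"]
    by (simp add: j_def[symmetric] k_def algebra_simps) (simp add: j_def)
  ultimately show ?thesis by blast
qed


text \<open>
  The centred product \<open>u\<close> is orthogonal to \<open>f (j + k)\<close> for all large \<open>k\<close>, and for suitable such \<open>k\<close>
  this function is as close to \<open>f j\<close> as desired. So \<open>u\<close> is orthogonal to the whole orbit.
\<close>

lemma product_constant:
  assumes mn: "m \<noteq> n"
  shows "AE x in M. f m x * f n x = (\<integral>x. f m x * f n x \<partial>M)"
proof -
  define c where "c = (\<integral>x. f m x * f n x \<partial>M)"
  define u where "u = (\<lambda>x. f m x * f n x - c)"
  have mL: "(\<lambda>x. f m x * f n x) \<in> L2 M" by (rule mult_L2[OF mn])
  have uL: "u \<in> L2 M" unfolding u_def by (intro L2_diff mL L2_const)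
  have far: "(\<integral>x. u x * cnj (f j x) \<partial>M) = 0" if "j \<noteq> m" "j \<noteq> n" for j
  proof -
    have "(\<integral>x. u x * cnj (f j x) \<partial>M)
      = 1 * (\<integral>x. (f m x * f n x) * cnj (f j x) \<partial>M) - c * (\<integral>x. 1 * cnj (f j x) \<partial>M)"
      using inner_diff_scale[OF mL L2_const[of 1] f_L2, of 1 c j] by (simp add: u_def)
    then show ?thesis using mult_ortho[OF mn that] f_mean[of j] by simp
  qed
  have "AE x in M. u x = 0"
  proof (rule complete)
    show "u \<in> L2_0 M"
      using uL L2_integrable[OF mL] by (simp add: L2_0_def u_def c_def prob_space)
    fix j
    define d where "d = (\<integral>x. u x * cnj (f j x) \<partial>M)"
    have "cmod d = 0"
    proof (rule zero_if_square_small[where C = "\<integral>x. (cmod (u x))\<^sup>2 \<partial>M"])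
      fix e :: real assume "0 < e"
      from orbit_rigid[OF this] obtain k where k: "k \<ge> max m n + 1 - j"
        "(\<integral>x. (cmod (f j x - f (j + k) x))\<^sup>2 \<partial>M) < e" by blast
      have fd: "(\<lambda>x. f j x - f (j + k) x) \<in> L2 M" by (intro L2_diff f_L2)
      have "d = (\<integral>x. u x * cnj (f j x) \<partial>M) - (\<integral>x. u x * cnj (f (j + k) x) \<partial>M)"
        using far[of "j + k"] k(1) by (auto simp: d_def)
      also have "\<dots> = (\<integral>x. u x * cnj (f j x) - u x * cnj (f (j + k) x) \<partial>M)"
        by (rule Bochner_Integration.integral_diff[symmetric]; rule L2_mult_cnj_integrable[OF uL f_L2])
      also have "\<dots> = (\<integral>x. u x * cnj (f j x - f (j + k) x) \<partial>M)" by (simp add: right_diff_distrib)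
      finally have "cmod d \<le> (\<integral>x. cmod (u x) * cmod (f j x - f (j + k) x) \<partial>M)"
        using integral_norm_bound[of M "\<lambda>x. u x * cnj (f j x - f (j + k) x)"]
        by (simp only: norm_mult complex_mod_cnj)
      then have "(cmod d)\<^sup>2 \<le> (\<integral>x. cmod (u x) * cmod (f j x - f (j + k) x) \<partial>M)\<^sup>2"
        by (intro power_mono) auto
      also have "\<dots> \<le> (\<integral>x. (cmod (u x))\<^sup>2 \<partial>M) * (\<integral>x. (cmod (f j x - f (j + k) x))\<^sup>2 \<partial>M)"
        by (rule L2_Cauchy_Schwarz[OF uL fd])
      also have "\<dots> \<le> (\<integral>x. (cmod (u x))\<^sup>2 \<partial>M) * e"
        using k(2) by (intro mult_left_mono) auto
      finally show "(cmod d)\<^sup>2 \<le> (\<integral>x. (cmod (u x))\<^sup>2 \<partial>M) * e" .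
    qed
    then show "(\<integral>x. u x * cnj (f j x) \<partial>M) = 0" by (simp add: d_def)
  qed
  then show ?thesis by (auto simp: u_def c_def)
qed

text \<open>
  As \<open>f k\<close> comes close to \<open>f 0\<close>, the constants \<open>f 0 * f k\<close> come close to the square in \<open>L\<^sup>1\<close>.
\<close>

lemma square_constant: "AE x in M. f 0 x * f 0 x = (\<integral>x. f 0 x * f 0 x \<partial>M)"
proof -
  define \<gamma> where "\<gamma> = (\<integral>x. f 0 x * f 0 x \<partial>M)"
  have sq: "integrable M (\<lambda>x. f 0 x * f 0 x)" by (rule L2_mult_integrable[OF f_L2 f_L2])
  define d where "d = (\<integral>x. cmod (f 0 x * f 0 x - \<gamma>) \<partial>M)"
  have "d = 0"
  proof (rule zero_if_square_small[where C = "4 * f_norm_sq"])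
    fix e :: real assume "0 < e"
    from orbit_rigid[OF this, of 1] obtain k where k: "k \<ge> 1" "(\<integral>x. (cmod (f 0 x - f (0 + k) x))\<^sup>2 \<partial>M) < e"
      by blast
    define c where "c = (\<integral>x. f 0 x * f k x \<partial>M)"
    have fd: "(\<lambda>x. f 0 x - f k x) \<in> L2 M" by (intro L2_diff f_L2)
    define D where "D = (\<integral>x. cmod (f 0 x) * cmod (f 0 x - f k x) \<partial>M)"
    have "AE x in M. f 0 x * f k x = c" unfolding c_def by (rule product_constant) (use k in simp)
    then have "AE x in M. cmod (f 0 x * f 0 x - c) = cmod (f 0 x) * cmod (f 0 x - f k x)"
      by eventually_elim (simp add: norm_mult[symmetric] right_diff_distrib)
    then have D: "(\<integral>x. cmod (f 0 x * f 0 x - c) \<partial>M) = D"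
      unfolding D_def by (intro integral_cong_AE) auto
    have "\<gamma> - c = (\<integral>x. f 0 x * f 0 x - c \<partial>M)"
      using sq by (simp add: \<gamma>_def prob_space)
    then have gc: "cmod (\<gamma> - c) \<le> D"
      using integral_norm_bound[of M "\<lambda>x. f 0 x * f 0 x - c"] by (simp only: D)
    have "d \<le> (\<integral>x. cmod (f 0 x * f 0 x - c) + cmod (\<gamma> - c) \<partial>M)"
      unfolding d_def
    proof (rule integral_mono)
      show "cmod (f 0 x * f 0 x - \<gamma>) \<le> cmod (f 0 x * f 0 x - c) + cmod (\<gamma> - c)" for x
        using norm_triangle_ineq4[of "f 0 x * f 0 x - c" "\<gamma> - c"] by simp
    qed (use sq in auto)
    also have "\<dots> = D + cmod (\<gamma> - c)" using sq D by (simp add: prob_space)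
    also have "\<dots> \<le> 2 * D" using gc by simp
    finally have "d\<^sup>2 \<le> (2 * D)\<^sup>2" by (intro power_mono) (auto simp: d_def)
    also have "\<dots> = 4 * D\<^sup>2" by (simp add: power_mult_distrib)
    also have "\<dots> \<le> 4 * (f_norm_sq * (\<integral>x. (cmod (f 0 x - f k x))\<^sup>2 \<partial>M))"
      using L2_Cauchy_Schwarz[OF f_L2 fd, of 0] by (simp add: D_def)
    also have "\<dots> \<le> 4 * (f_norm_sq * e)" using k(2) by (intro mult_left_mono) auto
    finally show "d\<^sup>2 \<le> 4 * f_norm_sq * e" by simp
  qed
  then have "AE x in M. cmod (f 0 x * f 0 x - \<gamma>) = 0"
    using integral_nonneg_eq_0_iff_AE[of M "\<lambda>x. cmod (f 0 x * f 0 x - \<gamma>)"] sq by (simp add: d_def)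
  then show ?thesis by (simp add: \<gamma>_def)
qed

text \<open>
  Both \<open>f m * f 0\<close> and \<open>f 0 * f 0\<close> are constant, the latter non-zero, so \<open>f m\<close> is a multiple of \<open>f 0\<close>
  on the whole space.
\<close>

theorem inconsistent: False
proof -
  define \<gamma> where "\<gamma> = (\<integral>x. f 0 x * f 0 x \<partial>M)"
  have sq: "AE x in M. f 0 x * f 0 x = \<gamma>" unfolding \<gamma>_def by (rule square_constant)
  have g: "\<gamma> \<noteq> 0"
  proof
    assume "\<gamma> = 0"
    then have "AE x in M. f 0 x = 0" using sq by simp
    then show False using f_nonzero by simp
  qed
  define c where "c m = (if m = 0 then 1 else (\<integral>x. f m x * f 0 x \<partial>M) / \<gamma>)" for m
  have "AE x in M. x \<in> space M \<longrightarrow> f m x = c m * f 0 x" for m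
  proof (cases "m = 0")
    case False
    from sq product_constant[OF False] show ?thesis
    proof eventually_elim
      case (elim x)
      have "f m x * \<gamma> = (f m x * f 0 x) * f 0 x" using elim(1) by (simp add: mult.assoc)
      then show ?case unfolding elim(2) using False g by (simp add: c_def field_simps)
    qed
  qed (simp add: c_def)
  then show False
    by (rule not_proportional_on_set[OF sets.top _ f_L2, rotated]) (simp add: prob_space)
qed

end

section \<open>Integer powers of a transformation\<close>

text \<open>
  The point map of which \<open>koopman_power M T n\<close> is the composition operator. The laws of a group
  action are available on \<open>space M\<close>; elsewhere the value of \<open>inv_into\<close> is arbitrary.
\<close>

definition iterate :: "'a measure \<Rightarrow> ('a \<Rightarrow> 'a) \<Rightarrow> int \<Rightarrow> 'a \<Rightarrow> 'a" where
  "iterate M T n = (if 0 \<le> n then T ^^ nat n else inv_into (space M) T ^^ nat (- n))"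

lemma koopman_funpow: "(koopman T ^^ k) f = (\<lambda>x. f ((T ^^ k) x))"
  by (induction k) (simp_all add: koopman_def funpow_swap1)

lemma koopman_power_eq_iterate: "koopman_power M T n f = (\<lambda>x. f (iterate M T n x))"
  by (simp add: koopman_power_def koopman_inv_def iterate_def koopman_funpow)

lemma iterate_0: "iterate M T 0 x = x"
  by (simp add: iterate_def)

context
  fixes M :: "'a measure" and T :: "'a \<Rightarrow> 'a"
  assumes T: "transformation M T"
begin

lemma T_space: "x \<in> space M \<Longrightarrow> T x \<in> space M"
  using T by (auto simp: transformation_def bij_betw_def)

lemma inv_space: "x \<in> space M \<Longrightarrow> inv_into (space M) T x \<in> space M"
  using T by (auto simp: transformation_def bij_betw_def intro: inv_into_into)

lemma T_inv: "x \<in> space M \<Longrightarrow> T (inv_into (space M) T x) = x"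
  using T by (auto simp: transformation_def bij_betw_def intro: f_inv_into_f)

lemma inv_T: "x \<in> space M \<Longrightarrow> inv_into (space M) T (T x) = x"
  using T by (auto simp: transformation_def bij_betw_def intro: inv_into_f_f)

lemma iterate_space: "x \<in> space M \<Longrightarrow> iterate M T n x \<in> space M"
proof -
  assume x: "x \<in> space M"
  have "(T ^^ k) x \<in> space M" "(inv_into (space M) T ^^ k) x \<in> space M" for k
    by (induction k) (simp_all add: x T_space inv_space)
  then show ?thesis by (simp add: iterate_def)
qed

lemma iterate_plus_1:
  assumes x: "x \<in> space M"
  shows "iterate M T (n + 1) x = T (iterate M T n x)"
proof (cases "0 \<le> n")
  case True
  then have "nat (n + 1) = Suc (nat n)" by simp
  then show ?thesis using True by (simp add: iterate_def)
next
  case False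
  define k where "k = nat (- n - 1)"
  have n: "n = - int k - 1" using False by (simp add: k_def)
  have y: "iterate M T (n + 1) x = (inv_into (space M) T ^^ k) x"
    using False by (cases "k = 0") (auto simp: iterate_def n)
  have "nat (- n) = Suc k" by (simp add: n)
  then have "iterate M T n x = inv_into (space M) T (iterate M T (n + 1) x)"
    unfolding y using False by (simp add: iterate_def)
  then show ?thesis using T_inv[OF iterate_space[OF x]] by simp
qed

lemma iterate_minus_1:
  "x \<in> space M \<Longrightarrow> iterate M T (n - 1) x = inv_into (space M) T (iterate M T n x)"
  using iterate_plus_1[of x "n - 1"] inv_T[OF iterate_space, of x "n - 1"] by simp

lemma iterate_add:
  assumes x: "x \<in> space M"
  shows "iterate M T (m + n) x = iterate M T m (iterate M T n x)"
proof (induction m rule: int_induct[where k = 0])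
  case (step1 i)
  then show ?case
    using iterate_plus_1[OF x, of "i + n"] iterate_plus_1[OF iterate_space[OF x], of i n]
    by (simp add: algebra_simps)
next
  case (step2 i)
  then show ?case
    using iterate_minus_1[OF x, of "i + n"] iterate_minus_1[OF iterate_space[OF x], of i n]
    by (simp add: algebra_simps)
qed (simp add: iterate_0)

lemma iterate_measurable: "iterate M T n \<in> M \<rightarrow>\<^sub>M M"
  and iterate_distr: "distr M M (iterate M T n) = M"
proof -
  have Tm: "T \<in> M \<rightarrow>\<^sub>M M" "inv_into (space M) T \<in> M \<rightarrow>\<^sub>M M" "distr M M T = M"
    using T by (auto simp: transformation_def)
  have Sd: "distr M M (inv_into (space M) T) = M"
  proof -
    have "distr M M (inv_into (space M) T) = distr (distr M M T) M (inv_into (space M) T)"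
      by (simp add: Tm)
    also have "\<dots> = distr M M (inv_into (space M) T \<circ> T)" using Tm by (intro distr_distr)
    also have "\<dots> = distr M M (\<lambda>x. x)" by (intro distr_cong) (auto simp: inv_T)
    finally show ?thesis by (simp add: distr_id2)
  qed
  have pow: "(U ^^ k) \<in> M \<rightarrow>\<^sub>M M \<and> distr M M (U ^^ k) = M"
    if U: "U \<in> M \<rightarrow>\<^sub>M M" "distr M M U = M" for U and k :: nat
  proof (induction k)
    case 0
    show ?case by (simp add: id_def distr_id2)
  next
    case (Suc k)
    have "distr M M (U \<circ> (U ^^ k)) = distr (distr M M (U ^^ k)) M U"
      using Suc U by (intro distr_distr[symmetric]) auto
    moreover have "U \<circ> (U ^^ k) \<in> M \<rightarrow>\<^sub>M M" using Suc U by (intro measurable_comp[of _ M M]) auto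
    ultimately show ?case using Suc U by (simp only: funpow.simps)
  qed
  show "iterate M T n \<in> M \<rightarrow>\<^sub>M M" "distr M M (iterate M T n) = M"
    using pow[OF Tm(1,3)] pow[OF Tm(2) Sd] by (simp_all add: iterate_def)
qed

lemma integral_iterate:
  fixes h :: "'a \<Rightarrow> 'b :: {banach, second_countable_topology}"
  assumes "h \<in> borel_measurable M"
  shows "(\<integral>x. h (iterate M T n x) \<partial>M) = (\<integral>x. h x \<partial>M)"
  using integral_distr[OF iterate_measurable assms, of n] by (simp add: iterate_distr)

lemma L2_iterate:
  assumes "u \<in> L2 M"
  shows "(\<lambda>x. u (iterate M T n x)) \<in> L2 M"
proof -
  have "integrable (distr M M (iterate M T n)) (\<lambda>x. (cmod (u x))\<^sup>2)"
    using L2_square_integrable[OF assms] by (simp add: iterate_distr)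
  then have "integrable M (\<lambda>x. (cmod (u (iterate M T n x)))\<^sup>2)"
    by (rule integrable_distr[OF iterate_measurable])
  then show ?thesis
    using measurable_compose[OF iterate_measurable L2_measurable[OF assms]] by (simp add: L2_def)
qed

text \<open>
  The functions whose whole orbit is orthogonal to \<open>u\<close> form a closed invariant subspace. It contains
  \<open>f\<close>, hence the cyclic space, hence \<open>u\<close>; so \<open>u\<close> is orthogonal to itself.
\<close>

lemma orbit_ortho_imp_AE_0:
  assumes u: "u \<in> cyclic_space M T {f}" and f: "f \<in> L2 M" and uL: "u \<in> L2 M"
    and ortho: "\<And>n. (\<integral>x. u x * cnj (f (iterate M T n x)) \<partial>M) = 0"
  shows "AE x in M. u x = 0"
proof -
  let ?J = "\<lambda>n v. \<integral>x. v (iterate M T n x) * cnj (u x) \<partial>M"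
  define V where "V = {v \<in> L2 M. \<forall>n. ?J n v = 0}"
  have int: "integrable M (\<lambda>x. v (iterate M T n x) * cnj (u x))" if "v \<in> L2 M" for v n
    by (rule L2_mult_cnj_integrable[OF L2_iterate[OF that] uL])
  have "closed_L2_subspace M V"
    unfolding closed_L2_subspace_def
  proof (intro conjI allI ballI impI)
    show "V \<subseteq> L2 M" "(\<lambda>x. 0) \<in> V" by (auto simp: V_def L2_zero)
  next
    fix v w assume vw: "v \<in> V" "w \<in> V"
    then have "?J n (\<lambda>x. v x + w x) = ?J n v + ?J n w" for n
      using int[of v n] int[of w n] by (simp add: V_def distrib_right)
    then show "(\<lambda>x. v x + w x) \<in> V" using vw by (simp add: V_def L2_add)
  next
    fix c v assume "v \<in> V"
    then show "(\<lambda>x. c * v x) \<in> V" by (simp add: V_def L2_scale mult.assoc)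
  next
    fix v assume v: "v \<in> L2 M" and approx: "\<forall>\<epsilon>>0. \<exists>g\<in>V. L2_norm M (\<lambda>x. v x - g x) < \<epsilon>"
    have "cmod (?J n v) = 0" for n
    proof (rule zero_if_square_small[where C = "\<integral>x. (cmod (u x))\<^sup>2 \<partial>M"])
      fix e :: real assume e: "0 < e"
      then obtain g where g: "g \<in> V" "L2_norm M (\<lambda>x. v x - g x) < sqrt e"
        using approx by (meson real_sqrt_gt_zero)
      have gL: "g \<in> L2 M" and gJ: "?J n g = 0" using g(1) by (auto simp: V_def)
      have dL: "(\<lambda>x. v x - g x) \<in> L2 M" by (rule L2_diff[OF v gL])
      have d: "(\<integral>x. (cmod (v x - g x))\<^sup>2 \<partial>M) < e"
        using g(2) by (simp add: L2_norm_def)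
      have "?J n v = ?J n v - ?J n g" by (simp add: gJ)
      also have "\<dots> = (\<integral>x. (v (iterate M T n x) - g (iterate M T n x)) * cnj (u x) \<partial>M)"
        using int[OF v, of n] int[OF gL, of n] by (simp add: left_diff_distrib)
      finally have "cmod (?J n v) \<le> (\<integral>x. cmod (v (iterate M T n x) - g (iterate M T n x)) * cmod (u x) \<partial>M)"
        using integral_norm_bound[of M "\<lambda>x. (v (iterate M T n x) - g (iterate M T n x)) * cnj (u x)"]
        by (simp only: norm_mult complex_mod_cnj)
      then have "(cmod (?J n v))\<^sup>2 \<le> (\<integral>x. cmod (v (iterate M T n x) - g (iterate M T n x)) * cmod (u x) \<partial>M)\<^sup>2"
        by (intro power_mono) auto
      also have "\<dots> \<le> (\<integral>x. (cmod (v (iterate M T n x) - g (iterate M T n x)))\<^sup>2 \<partial>M) * (\<integral>x. (cmod (u x))\<^sup>2 \<partial>M)"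
        by (rule L2_Cauchy_Schwarz[OF L2_iterate[OF dL] uL])
      also have "(\<integral>x. (cmod (v (iterate M T n x) - g (iterate M T n x)))\<^sup>2 \<partial>M) = (\<integral>x. (cmod (v x - g x))\<^sup>2 \<partial>M)"
        by (rule integral_iterate) (use L2_measurable[OF dL] in measurable)
      also have "(\<integral>x. (cmod (v x - g x))\<^sup>2 \<partial>M) * (\<integral>x. (cmod (u x))\<^sup>2 \<partial>M) \<le> e * (\<integral>x. (cmod (u x))\<^sup>2 \<partial>M)"
        using d by (intro mult_right_mono) auto
      finally show "(cmod (?J n v))\<^sup>2 \<le> (\<integral>x. (cmod (u x))\<^sup>2 \<partial>M) * e" by (simp add: mult.commute)
    qed
    then show "v \<in> V" using v by (simp add: V_def)
  qed
  moreover have "koopman_invariant M T V"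
    unfolding koopman_invariant_def
  proof (intro ballI conjI)
    fix v assume v: "v \<in> V"
    have 1: "koopman T v \<in> L2 M"
      using L2_iterate[of v 1] v by (simp add: V_def iterate_def koopman_def)
    have 2: "koopman_inv M T v \<in> L2 M"
      using L2_iterate[of v "-1"] v by (simp add: V_def iterate_def koopman_def koopman_inv_def)
    have "?J n (koopman T v) = ?J (n + 1) v" for n
      by (rule Bochner_Integration.integral_cong) (simp_all add: koopman_def iterate_plus_1)
    then show "koopman T v \<in> V" using v 1 by (simp add: V_def)
    have "?J n (koopman_inv M T v) = ?J (n - 1) v" for n
      by (rule Bochner_Integration.integral_cong) (simp_all add: koopman_inv_def koopman_def iterate_minus_1)
    then show "koopman_inv M T v \<in> V" using v 2 by (simp add: V_def)
  qed
  moreover have "f \<in> V"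
  proof -
    have "?J n f = cnj (\<integral>x. u x * cnj (f (iterate M T n x)) \<partial>M)" for n
      by (subst Bochner_Integration.integral_cnj[symmetric]) (simp add: mult.commute)
    then show ?thesis using ortho f by (simp add: V_def)
  qed
  ultimately have "u \<in> V" using u unfolding cyclic_space_def by blast
  then have "?J 0 u = 0" by (simp add: V_def)
  then show ?thesis using L2_eq_0_AE[OF uL] by (simp add: iterate_0)
qed

end

text \<open>
  The 3-fold Lebesgue condition speaks of products of two elements with \<open>f\<close> itself. Shifting time by
  \<open>- j\<close> moves the product of \<open>m\<close> and \<open>n\<close> paired with \<open>j\<close> to that situation; for square
  integrability any shift making both times non-zero will do.
\<close>

lemma threefold_orbit_of_generator:
  assumes "prob_space M" "nonatomic M" and T: "transformation M T"
    and f: "threefold_Lebesgue M T f" and gen: "L2_0 M = cyclic_space M T {f}"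
  shows "threefold_orbit M (\<lambda>n x. f (iterate M T n x))"
proof -
  interpret prob_space M by fact
  have fL: "f \<in> L2 M" and nz: "\<not> (AE x in M. f x = 0)"
    using f by (auto simp: threefold_Lebesgue_def)
  have fm [measurable]: "f \<in> borel_measurable M" by (rule L2_measurable[OF fL])
  have three: "(\<lambda>x. f (iterate M T a x) * f (iterate M T b x)) \<in> L2 M"
    "(\<integral>x. f (iterate M T a x) * f (iterate M T b x) * cnj (f x) \<partial>M) = 0"
    if "a \<noteq> 0" "b \<noteq> 0" "a \<noteq> b" for a b
    using f that unfolding threefold_Lebesgue_def koopman_power_eq_iterate by auto
  have itm [measurable]: "iterate M T n \<in> M \<rightarrow>\<^sub>M M" for n by (rule iterate_measurable[OF T])
  have shift: "iterate M T m x = iterate M T (m - j) (iterate M T j x)" if "x \<in> space M" for m j x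
    using iterate_add[OF T that, of "m - j" j] by simp
  have "f \<in> cyclic_space M T {f}" by (auto simp: cyclic_space_def)
  then have mean: "(\<integral>x. f x \<partial>M) = 0" using gen by (auto simp: L2_0_def)
  show ?thesis
  proof
    show "nonatomic M" by fact
    show "(\<lambda>x. f (iterate M T n x)) \<in> L2 M" for n by (rule L2_iterate[OF T fL])
    show "(\<integral>x. f (iterate M T n x) \<partial>M) = 0" for n
      using integral_iterate[OF T fm, of n] mean by simp
    show "\<not> (AE x in M. f (iterate M T 0 x) = 0)" using nz by (simp add: iterate_0)
    fix m n j k :: int
    show "(\<lambda>x. f (iterate M T m x) * f (iterate M T n x)) \<in> L2 M" if "m \<noteq> n"
    proof -
      define i where "i = max m n + 1"
      let ?g = "\<lambda>x. f (iterate M T (m - i) x) * f (iterate M T (n - i) x)"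
      have "(\<lambda>x. ?g (iterate M T i x)) \<in> L2 M"
        by (rule L2_iterate[OF T], rule three) (use that in \<open>auto simp: i_def\<close>)
      then show ?thesis
        by (rule L2_cong_AE) (auto simp: shift[of _ m i] shift[of _ n i])
    qed
    show "(\<integral>x. f (iterate M T m x) * f (iterate M T n x) * cnj (f (iterate M T j x)) \<partial>M) = 0"
      if "m \<noteq> n" "j \<noteq> m" "j \<noteq> n"
    proof -
      let ?g = "\<lambda>x. f (iterate M T (m - j) x) * f (iterate M T (n - j) x) * cnj (f x)"
      have "(\<integral>x. f (iterate M T m x) * f (iterate M T n x) * cnj (f (iterate M T j x)) \<partial>M)
        = (\<integral>x. ?g (iterate M T j x) \<partial>M)"
        by (rule Bochner_Integration.integral_cong) (auto simp: shift[of _ m j] shift[of _ n j])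
      also have "\<dots> = (\<integral>x. ?g x \<partial>M)" by (rule integral_iterate[OF T]) measurable
      also have "\<dots> = 0" by (rule three(2)) (use that in auto)
      finally show ?thesis .
    qed
    show "AE x in M. u x = 0"
      if "u \<in> L2_0 M" "\<And>j. (\<integral>x. u x * cnj (f (iterate M T j x)) \<partial>M) = 0" for u
      by (rule orbit_ortho_imp_AE_0[OF T _ fL _ that(2)]) (use that(1) gen in \<open>auto simp: L2_0_def\<close>)
    show "(\<integral>x. (cmod (f (iterate M T (m + k) x) - f (iterate M T (n + k) x)))\<^sup>2 \<partial>M)
      = (\<integral>x. (cmod (f (iterate M T m x) - f (iterate M T n x)))\<^sup>2 \<partial>M)"
    proof -
      let ?g = "\<lambda>x. (cmod (f (iterate M T m x) - f (iterate M T n x)))\<^sup>2"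
      have "(\<integral>x. (cmod (f (iterate M T (m + k) x) - f (iterate M T (n + k) x)))\<^sup>2 \<partial>M)
        = (\<integral>x. ?g (iterate M T k x) \<partial>M)"
        by (rule Bochner_Integration.integral_cong) (auto simp: iterate_add[OF T])
      also have "\<dots> = (\<integral>x. ?g x \<partial>M)" by (rule integral_iterate[OF T]) measurable
      finally show ?thesis .
    qed
    have "(\<lambda>x. (cmod (f x))\<^sup>2) \<in> borel_measurable M" by measurable
    from integral_iterate[OF T this, of n]
    show "(\<integral>x. (cmod (f (iterate M T n x)))\<^sup>2 \<partial>M) = (\<integral>x. (cmod (f (iterate M T 0 x)))\<^sup>2 \<partial>M)"
      by (simp add: iterate_0)
    show "(\<integral>x. tail R (f (iterate M T n x)) \<partial>M) = (\<integral>x. tail R (f (iterate M T 0 x)) \<partial>M)" for R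
      using integral_iterate[OF T tail_measurable[OF fm], of R n] by (simp add: iterate_0)
  qed
qed

theorem theorem1p7:
  fixes M :: "'a measure"
  assumes "prob_space M" and "standard_Borel M" and "nonatomic M"
  shows "\<not> (\<exists>T f. transformation M T \<and> threefold_Lebesgue M T f \<and>
                 L2_0 M = cyclic_space M T {f})"
  using threefold_orbit.inconsistent[OF threefold_orbit_of_generator[OF assms(1,3)]] by blast

end
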